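(* Let $X=[0,1)$, let $T:X\to X$ be the continued fraction map, $T(x)=\frac1x-\lfloor\frac1x\rfloor$ for $x\neq0$ and $T(0)=0$, and let $\mu(A)=\frac{1}{\log 2}\int_A\frac{1}{1+x}\,dx$ be the Gauss measure. Let $x\in[0,1)$ be such that the set of empirical probability measures $\{\mathcal{E}(x,n)\}_{n=1}^\infty$ is tight. Let $\psi:\mathbb{R}_{>0}\to\mathbb{R}_{\ge0}$ satisfy $\psi(t)=O\bigl(e^{\eta\sqrt{\log(1/t)}}\bigr)$ as $t\to0$ for any $\eta>0$. If for any cylinder set $I$ $$\limsup_{N\to\infty}\frac1N\sum_{n=0}^{N-1}\chi_I(T^n x)\le\mu(I)\,\psi(\mu(I)),$$ then for any Borel set $B\subseteq X$ $$\lim_{N\to\infty}\frac1N\sum_{n=0}^{N-1}\chi_B(T^n x)=\mu(B).$$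
   Context: For $y\in X$ with $T^{i-1}y\neq0$, the $i$-th continued fraction digit of $y$ is $a_i(y)=\lfloor 1/T^{i-1}y\rfloor\in\mathbb{N}=\{1,2,\dots\}$. For $n\ge1$ and $b_1,\dots,b_n\in\mathbb{N}$, the corresponding cylinder set is the set of $y\in X$ whose first $n$ digits exist and satisfy $a_i(y)=b_i$ for $1\le i\le n$. The space $X$ carries the topology and Borel $\sigma$-algebra generated by the cylinder sets; compactness below refers to this topology. $\chi_E$ denotes the indicator function of $E$. For $y\in X$ and $n\ge1$, the empirical probability measure is $\mathcal{E}(y,n)=\frac1n\sum_{i=0}^{n-1}\delta_{T^i y}$, where $\delta_z$ is the unit point mass at $z$. A set $M$ of probability measures on $X$ is tight if for every $\epsilon>0$ there is a compact set $K\subseteq X$ such that $\nu(X\setminus K)<\epsilon$ for every $\nu\in M$.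
   Formalization: Tightness uses compact sets in the cylinder topology on the irrationals of [0,1) only (on all of [0,1) it is vacuous and x=0, ψ=0 is a counterexample), and B must have μ-null boundary in that topology, since the claim fails when B is the orbit of x. *)

theory Defs
  imports "HOL-Probability.Probability" "HOL-Library.Landau_Symbols"
begin

definition cf_X :: "real set" where
  "cf_X = {0..<1}"

definition cf_T :: "real \<Rightarrow> real" where
  "cf_T x = (if x = 0 then 0 else 1 / x - of_int \<lfloor>1 / x\<rfloor>)"

definition gauss_measure :: "real measure" where
  "gauss_measure =
     density (restrict_space lborel cf_X) (\<lambda>x. ennreal (1 / ln 2 * (1 / (1 + x))))"

text \<open>The list \<open>bs\<close> is indexed from \<open>0\<close>: its entry \<open>bs ! i\<close> prescribes the digit
  number \<open>i + 1\<close>, which exists iff the \<open>i\<close>-th iterate of the map is nonzero.\<close>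

definition cf_cylinder :: "nat list \<Rightarrow> real set" where
  "cf_cylinder bs =
     {y \<in> cf_X. \<forall>i < length bs. (cf_T ^^ i) y \<noteq> 0 \<and> \<lfloor>1 / (cf_T ^^ i) y\<rfloor> = int (bs ! i)}"

definition cf_cylinders :: "real set set" where
  "cf_cylinders = {cf_cylinder bs | bs. bs \<noteq> [] \<and> (\<forall>b \<in> set bs. 1 \<le> b)}"

definition cf_borel :: "real measure" where
  "cf_borel = sigma cf_X cf_cylinders"

text \<open>The cylinder topology, on the points all of whose digits exist (the irrationals of
  \<open>cf_X\<close>), where it is the topology of the digit sequences in the Baire space. It has to be
  restricted to these points: no cylinder contains \<open>0\<close>, so on all of \<open>cf_X\<close> the only open
  neighbourhood of \<open>0\<close> would be \<open>cf_X\<close>, the whole of \<open>cf_X\<close> would be compact, and every set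
  of probability measures would be tight. As rational points have rational orbits, their
  empirical measures do not form a tight set.\<close>

definition cf_topology :: "real topology" where
  "cf_topology = subtopology (topology_generated_by cf_cylinders) (cf_X - \<rat>)"

definition empirical_measure :: "real \<Rightarrow> nat \<Rightarrow> real measure" where
  "empirical_measure y n =
     measure_of cf_X (sets cf_borel)
       (\<lambda>A. ennreal (1 / real n) * (\<Sum>i<n. emeasure (return cf_borel ((cf_T ^^ i) y)) A))"

definition cf_tight :: "real measure set \<Rightarrow> bool" where
  "cf_tight M \<longleftrightarrow>
     (\<forall>\<epsilon>>0. \<exists>K. compactin cf_topology K \<and> (\<forall>\<nu>\<in>M. measure \<nu> (cf_X - K) < \<epsilon>))"

lemma space_cf_borel: "space cf_borel = cf_X"
  and sets_cf_borel: "sets cf_borel = sigma_sets cf_X cf_cylinders"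
  by (auto simp: cf_borel_def cf_cylinders_def cf_cylinder_def
      intro!: space_measure_of sets_measure_of)

lemma cf_T_in_X: "y \<in> cf_X \<Longrightarrow> (cf_T ^^ i) y \<in> cf_X"
proof (induction i)
  case (Suc i)
  have "cf_T z \<in> cf_X" for z
    using frac_ge_0[of "1 / z"] frac_lt_1[of "1 / z"]
    by (simp add: cf_T_def cf_X_def frac_def)
  then show ?case
    by simp
qed simp

text \<open>\<open>measure_of\<close> yields the zero measure unless the given set function is a measure, so
  this has to be checked for the empirical measures.\<close>

lemma emeasure_empirical_measure:
  assumes "A \<in> sets cf_borel"
  shows "emeasure (empirical_measure y n) A =
           ennreal (1 / real n) * (\<Sum>i<n. indicator A ((cf_T ^^ i) y))"
proof -
  have "emeasure (empirical_measure y n) A =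
      ennreal (1 / real n) * (\<Sum>i<n. emeasure (return cf_borel ((cf_T ^^ i) y)) A)"
  proof (rule emeasure_measure_of[OF empirical_measure_def])
    show "sets cf_borel \<subseteq> Pow cf_X"
      using sets.space_closed[of cf_borel] by (simp add: space_cf_borel)
    have "sets (empirical_measure y n) = sigma_sets cf_X (sets cf_borel)"
      unfolding empirical_measure_def
      by (rule sets_measure_of) (use sets.space_closed[of cf_borel] in \<open>simp add: space_cf_borel\<close>)
    also have "\<dots> = sets cf_borel"
      using sets.sigma_sets_eq[of cf_borel] by (simp add: space_cf_borel)
    finally have eq: "sets (empirical_measure y n) = sets cf_borel" .
    then show "A \<in> sets (empirical_measure y n)"
      using assms by simp
    show "positive (sets (empirical_measure y n))
        (\<lambda>A. ennreal (1 / real n) * (\<Sum>i<n. emeasure (return cf_borel ((cf_T ^^ i) y)) A))"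
      by (simp add: positive_def)
    show "countably_additive (sets (empirical_measure y n))
        (\<lambda>A. ennreal (1 / real n) * (\<Sum>i<n. emeasure (return cf_borel ((cf_T ^^ i) y)) A))"
      unfolding eq countably_additive_def
    proof safe
      fix F :: "nat \<Rightarrow> real set"
      assume F: "range F \<subseteq> sets cf_borel" "disjoint_family F"
      have "(\<Sum>k. ennreal (1 / real n) * (\<Sum>i<n. emeasure (return cf_borel ((cf_T ^^ i) y)) (F k)))
        = ennreal (1 / real n) * (\<Sum>k. \<Sum>i<n. emeasure (return cf_borel ((cf_T ^^ i) y)) (F k))"
        by simp
      also have "(\<Sum>k. \<Sum>i<n. emeasure (return cf_borel ((cf_T ^^ i) y)) (F k)) =
          (\<Sum>i<n. \<Sum>k. emeasure (return cf_borel ((cf_T ^^ i) y)) (F k))"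
        by (rule suminf_sum) simp
      also have "\<dots> = (\<Sum>i<n. emeasure (return cf_borel ((cf_T ^^ i) y)) (\<Union>k. F k))"
        using F by (intro sum.cong refl suminf_emeasure) auto
      finally show "(\<Sum>k. ennreal (1 / real n) *
            (\<Sum>i<n. emeasure (return cf_borel ((cf_T ^^ i) y)) (F k))) =
          ennreal (1 / real n) *
            (\<Sum>i<n. emeasure (return cf_borel ((cf_T ^^ i) y)) (\<Union>k. F k))" .
    qed
  qed
  then show ?thesis
    using assms by simp
qed

text \<open>The Gauss measure carries the Euclidean Borel sets; it is defined on every set of
  \<open>cf_borel\<close>.\<close>

lemma sets_cf_borel_subset: "sets cf_borel \<subseteq> sets gauss_measure"
proof -
  have m [measurable]: "(cf_T ^^ i) \<in> borel_measurable borel" for i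
  proof (induction i)
    case (Suc i)
    have "cf_T \<in> borel_measurable borel"
      unfolding cf_T_def[abs_def] by measurable
    with Suc show ?case
      by (simp add: measurable_comp)
  qed simp
  have c: "cf_cylinder bs \<in> sets gauss_measure" for bs
  proof -
    have "{y. \<forall>i\<in>{..<length bs}. (cf_T ^^ i) y \<noteq> 0 \<and> \<lfloor>1 / (cf_T ^^ i) y\<rfloor> = int (bs ! i)}
        \<in> sets borel"
      by measurable
    moreover have "cf_cylinder bs = cf_X \<inter>
        {y. \<forall>i\<in>{..<length bs}. (cf_T ^^ i) y \<noteq> 0 \<and> \<lfloor>1 / (cf_T ^^ i) y\<rfloor> = int (bs ! i)}"
      by (auto simp: cf_cylinder_def)
    ultimately show ?thesis
      by (auto simp: gauss_measure_def sets_restrict_space)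
  qed
  have "sigma_sets (space gauss_measure) cf_cylinders \<subseteq> sets gauss_measure"
    by (rule sets.sigma_sets_subset) (use c in \<open>auto simp: cf_cylinders_def\<close>)
  moreover have "space gauss_measure = cf_X"
    by (simp add: gauss_measure_def space_restrict_space)
  ultimately show ?thesis
    by (simp add: sets_cf_borel)
qed

end

theory Submission
  imports Defs
begin

text \<open>Put \<open>p\<^sub>k(s) = (1 + s) / ((k + s)(k + 1 + s))\<close>. The products of these weights along
  \<open>s \<mapsto> 1 / (k + s)\<close> are the measures of cylinders under the densities
  \<open>(1 + s) / (1 + s x)\<^sup>2\<close>, which are the conditional Lebesgue densities given a past; the Gauss measure
  is their mixture. The transfer operator \<open>f \<mapsto> (\<lambda>s. \<Sum>k. p\<^sub>k(s) f(1 / (k + s)))\<close> contracts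
  Lipschitz constants by \<open>7/8\<close>, so a word \<open>w\<close> read after a long gap has conditional probability close
  to its Gauss measure, whatever the past.

  Weight a long word by \<open>(1 + t)\<close> to the number of occurrences of \<open>w\<close> at sparse positions. By the
  previous paragraph, the sum of these weights against \<open>\<mu>(I)\<^bsup>1 - \<eta>\<^esup>\<close> over words made of \<open>m\<close>
  blocks is at most \<open>\<rho>\<^bsup>m\<^esup>\<close> with \<open>\<rho>\<close> close to \<open>1 + t \<mu>(w)\<close>. The growth condition on
  \<open>\<psi>\<close> gives \<open>\<mu>(I) \<psi>(\<mu>(I)) \<le> C \<mu>(I)\<^bsup>1 - \<eta>\<^esup>\<close>, so the same bound holds for the orbit
  average of the weights, up to words with large digits, which are rare by tightness. Taking logarithms,
  by concavity, bounds the upper frequency of \<open>w\<close> by \<open>ln \<rho> / ln (1 + t)\<close>, hence by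
  \<open>\<mu>(w)\<close> as \<open>t\<close> tends to \<open>0\<close>. Since no mass escapes, upper bounds on all cylinders of a given
  rank force equality.\<close>

section \<open>Cylinder weights and the transfer operator\<close>

text \<open>The parameter \<open>s\<close> encodes the past: it is the ratio q_{n-1}/q_n of the last
  two convergent denominators. The formula is the mass of the interval from 1/(k+1) to 1/k under the
  density (1+s)/(1+sx)^2.\<close>

definition cf_prob :: "nat \<Rightarrow> real \<Rightarrow> real" where
  "cf_prob k s = (1 + s) / ((real k + s) * (real k + 1 + s))"

fun word_prob :: "nat list \<Rightarrow> real \<Rightarrow> real" where
  "word_prob [] s = 1"
| "word_prob (k # u) s = cf_prob k s * word_prob u (1 / (real k + s))"

text \<open>Follows q_{n-1}/q_n while digits are appended. The first digit ends up innermost,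
  whereas in \<open>cf_branch\<close> it is outermost; the two functions read the word from opposite
  ends.\<close>

fun word_end :: "nat list \<Rightarrow> real \<Rightarrow> real" where
  "word_end [] s = s"
| "word_end (k # u) s = word_end u (1 / (real k + s))"

fun cf_branch :: "nat list \<Rightarrow> real \<Rightarrow> real" where
  "cf_branch [] y = y"
| "cf_branch (k # u) y = 1 / (real k + cf_branch u y)"

text \<open>The distribution function on [0,1] of the density (1+s)/(1+sx)^2.\<close>

definition cond_cdf :: "real \<Rightarrow> real \<Rightarrow> real" where
  "cond_cdf s x = (1 + s) * x / (1 + s * x)"

lemma inverse_digit_in_unit:
  assumes "1 \<le> k" "0 \<le> (s::real)"
  shows "1 / (real k + s) \<in> {0..1}"
  using assms by (auto simp: field_simps)

lemma word_prob_append: "word_prob (u @ v) s = word_prob u s * word_prob v (word_end u s)"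
  by (induction u arbitrary: s) auto

lemma word_end_in_unit:
  assumes "\<forall>k\<in>set u. 1 \<le> k" "s \<in> {0..1}"
  shows "word_end u s \<in> {0..1}"
  using assms
proof (induction u arbitrary: s)
  case (Cons k u)
  then show ?case using inverse_digit_in_unit[of k s] by simp
qed simp

lemma cf_branch_in_unit:
  assumes "\<forall>k\<in>set u. 1 \<le> k" "y \<in> {0..1}"
  shows "cf_branch u y \<in> {0..1}"
  using assms
proof (induction u)
  case (Cons k u)
  then show ?case using inverse_digit_in_unit[of k "cf_branch u y"] by simp
qed simp

lemma cf_prob_pos: "1 \<le> k \<Longrightarrow> 0 \<le> s \<Longrightarrow> 0 < cf_prob k s"
  by (auto simp: cf_prob_def intro!: divide_pos_pos mult_pos_pos)

lemma cf_prob_le_half: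
  assumes "1 \<le> k" "s \<in> {0..1}"
  shows "cf_prob k s \<le> 1 / 2"
proof -
  have "1 + s \<le> real k + s" "2 \<le> real k + 1 + s" using assms by auto
  then have "(1 + s) * 2 \<le> (real k + s) * (real k + 1 + s)"
    using assms by (intro mult_mono) auto
  then show ?thesis using assms unfolding cf_prob_def
    by (subst divide_le_eq) (auto intro!: mult_pos_pos)
qed

lemma cf_prob_le_square:
  assumes "1 \<le> k" "s \<in> {0..1}"
  shows "cf_prob k s \<le> 2 / real k ^ 2"
proof -
  have "cf_prob k s \<le> 2 / (real k * real k)"
    unfolding cf_prob_def using assms by (intro frac_le mult_mono mult_pos_pos) auto
  then show ?thesis by (simp add: power2_eq_square)
qed

lemma word_prob_pos:
  assumes "\<forall>k\<in>set u. 1 \<le> k" "0 \<le> s"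
  shows "0 < word_prob u s"
  using assms by (induction u arbitrary: s) (auto intro!: mult_pos_pos cf_prob_pos)

lemma word_prob_le_power_half:
  assumes "\<forall>k\<in>set u. 1 \<le> k" "s \<in> {0..1}"
  shows "word_prob u s \<le> (1 / 2) ^ length u"
  using assms
proof (induction u arbitrary: s)
  case (Cons k u)
  have "word_prob u (1 / (real k + s)) \<le> (1 / 2) ^ length u"
    using Cons inverse_digit_in_unit[of k s] by simp
  moreover have "0 < word_prob u (1 / (real k + s))"
    using Cons.prems by (intro word_prob_pos) auto
  ultimately show ?case
    using mult_mono[OF cf_prob_le_half[of k s], of "word_prob u (1 / (real k + s))" "(1/2) ^ length u"] Cons.prems
    by (simp add: mult.commute)
qed simp

lemma word_prob_le_1:
  assumes "\<forall>k\<in>set u. 1 \<le> k" "s \<in> {0..1}"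
  shows "word_prob u s \<le> 1"
  using word_prob_le_power_half[OF assms] power_le_one[of "1/2::real" "length u"] by simp

text \<open>Change of variables x = 1/(k+y). Restricting the density for \<open>s\<close> to first
  digit \<open>k\<close> and mapping forward gives the density for 1/(k+s), scaled by
  \<open>cf_prob k s\<close>.\<close>

lemma cf_prob_cond_cdf:
  assumes "1 \<le> k" "0 \<le> s" "0 \<le> y"
  shows "cf_prob k s * cond_cdf (1 / (real k + s)) y = cond_cdf s (1 / real k) - cond_cdf s (1 / (real k + y))"
proof -
  have p: "real k > 0" "real k + s > 0" "real k + 1 + s > 0" "real k + s + y > 0" "real k + y > 0"
    using assms by auto
  have "cond_cdf (1 / (real k + s)) y = (real k + 1 + s) * y / (real k + s + y)"
    using p by (simp add: cond_cdf_def divide_simps)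
  then have l: "cf_prob k s * cond_cdf (1 / (real k + s)) y = (1 + s) * y / ((real k + s) * (real k + s + y))"
    using p by (simp add: cf_prob_def)
  have "cond_cdf s (1 / z) = (1 + s) / (z + s)" if "z > 0" for z
  proof -
    have "1 + s * (1 / z) = (z + s) / z" using that by (simp add: field_simps)
    then show ?thesis using that by (simp add: cond_cdf_def)
  qed
  from this[of "real k"] this[of "real k + y"]
  have "cond_cdf s (1 / real k) = (1 + s) / (real k + s)"
    "cond_cdf s (1 / (real k + y)) = (1 + s) / (real k + s + y)"
    using p by (simp_all add: add_ac)
  then show ?thesis unfolding l using p by (simp only:) (simp add: divide_simps, simp add: algebra_simps)
qed

text \<open>Each digit reverses the orientation, whence the sign. In this closed form
  \<open>s\<close> enters only through \<open>cond_cdf\<close>, so regularity in \<open>s\<close>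
  does not deteriorate with the length of the word.\<close>

lemma word_prob_eq_cond_cdf:
  assumes "\<forall>k\<in>set u. 1 \<le> k" "0 \<le> s"
  shows "word_prob u s = (-1) ^ length u * (cond_cdf s (cf_branch u 1) - cond_cdf s (cf_branch u 0))"
  using assms
proof (induction u arbitrary: s)
  case Nil
  then show ?case by (simp add: cond_cdf_def)
next
  case (Cons k u)
  let ?t = "1 / (real k + s)"
  have b: "0 \<le> cf_branch u 0" "0 \<le> cf_branch u 1"
    using cf_branch_in_unit[of u 0] cf_branch_in_unit[of u 1] Cons.prems by auto
  have "word_prob (k # u) s = (-1) ^ length u *
      (cf_prob k s * cond_cdf ?t (cf_branch u 1) - cf_prob k s * cond_cdf ?t (cf_branch u 0))"
    using Cons.prems by (simp add: Cons.IH right_diff_distrib mult.left_commute)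
  also have "\<dots> = (-1) ^ length (k # u) *
      (cond_cdf s (cf_branch (k # u) 1) - cond_cdf s (cf_branch (k # u) 0))"
    using Cons.prems b by (simp add: cf_prob_cond_cdf) (simp add: algebra_simps)
  finally show ?case .
qed

text \<open>The difference quotient in \<open>s\<close> is x(1-x)/((1+sx)(1+tx)), which lies between
  0 and 1.\<close>

lemma cond_cdf_lipschitz:
  assumes "x \<in> {0..1}" "s \<in> {0..1}" "t \<in> {0..1}"
  shows "\<bar>cond_cdf s x - cond_cdf t x\<bar> \<le> \<bar>s - t\<bar>"
proof -
  have p: "1 + s * x \<ge> 1" "1 + t * x \<ge> 1" using assms by auto
  define r where "r = x * (1 - x) / ((1 + s * x) * (1 + t * x))"
  have "cond_cdf s x - cond_cdf t x = (s - t) * r"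
    using p by (simp add: cond_cdf_def r_def divide_simps) (simp add: algebra_simps)
  moreover have "r \<le> 1"
    unfolding r_def
  proof -
    have "x * (1 - x) \<le> 1 * 1" using assms by (intro mult_mono) auto
    moreover have "1 * 1 \<le> (1 + s * x) * (1 + t * x)" using p by (intro mult_mono) auto
    ultimately show "x * (1 - x) / ((1 + s * x) * (1 + t * x)) \<le> 1"
      using p by (subst divide_le_eq_1_pos) auto
  qed
  moreover have "0 \<le> r" unfolding r_def
    using p assms by (intro divide_nonneg_nonneg mult_nonneg_nonneg) auto
  ultimately show ?thesis
    by (simp add: abs_mult mult_left_le)
qed

text \<open>Each endpoint of the cylinder contributes 1 to the constant, which is therefore the same
  for all words.\<close>

lemma word_prob_lipschitz:
  assumes "\<forall>k\<in>set u. 1 \<le> k"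
  shows "2-lipschitz_on {0..1} (word_prob u)"
proof (rule lipschitz_onI)
  fix s t :: real assume st: "s \<in> {0..1}" "t \<in> {0..1}"
  have b: "cf_branch u 0 \<in> {0..1}" "cf_branch u 1 \<in> {0..1}"
    using cf_branch_in_unit[OF assms] by auto
  have "word_prob u s - word_prob u t = (-1) ^ length u *
     ((cond_cdf s (cf_branch u 1) - cond_cdf t (cf_branch u 1))
       - (cond_cdf s (cf_branch u 0) - cond_cdf t (cf_branch u 0)))"
    using st by (simp add: word_prob_eq_cond_cdf[OF assms] algebra_simps)
  then have "\<bar>word_prob u s - word_prob u t\<bar> =
     \<bar>(cond_cdf s (cf_branch u 1) - cond_cdf t (cf_branch u 1))
       - (cond_cdf s (cf_branch u 0) - cond_cdf t (cf_branch u 0))\<bar>"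
    by (simp add: abs_mult power_abs)
  also have "\<dots> \<le> 2 * \<bar>s - t\<bar>"
    using add_mono[OF cond_cdf_lipschitz[OF b(2) st] cond_cdf_lipschitz[OF b(1) st]]
    by (intro order.trans[OF abs_triangle_ineq4]) simp
  finally show "dist (word_prob u s) (word_prob u t) \<le> 2 * dist s t"
    by (simp add: dist_real_def)
qed simp

section \<open>The transfer operator: contraction and invariance of the Gauss measure\<close>

lemma sum_cf_prob:
  assumes "0 \<le> s"
  shows "(\<Sum>j<n. cf_prob (Suc j) s) = 1 - (1 + s) / (real n + 1 + s)"
proof (induction n)
  case (Suc n)
  have p: "real n + 1 + s > 0" "real n + 2 + s > 0" using assms by auto
  have "cf_prob (Suc n) s = (1 + s) / ((real n + 1 + s) * (real n + 2 + s))"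
    by (simp add: cf_prob_def add_ac)
  also have "\<dots> = (1 + s) / (real n + 1 + s) - (1 + s) / (real n + 2 + s)"
    using p by (simp add: divide_simps) (simp add: algebra_simps)
  finally show ?case using Suc by (simp add: add_ac)
qed (use assms in auto)

text \<open>The expectation of \<open>f\<close> at the next parameter 1/(k+s). It is also the
  transfer operator of the continued fraction map normalised by the Gauss density. The index
  \<open>j\<close> stands for the digit \<open>Suc j\<close>.\<close>

definition cf_transfer :: "(real \<Rightarrow> real) \<Rightarrow> real \<Rightarrow> real" where
  "cf_transfer f s = (\<Sum>j. cf_prob (Suc j) s * f (1 / (real (Suc j) + s)))"

context
  fixes f :: "real \<Rightarrow> real"
  assumes f01: "f \<in> {0..1} \<rightarrow> {0..1}"
begin

lemma apply_digit_in_unit: "0 \<le> s \<Longrightarrow> f (1 / (real (Suc j) + s)) \<in> {0..1}"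
  using f01 inverse_digit_in_unit[of "Suc j" s] by auto

lemma transfer_term_nonneg: "0 \<le> s \<Longrightarrow> 0 \<le> cf_prob (Suc j) s * f (1 / (real (Suc j) + s))"
  using apply_digit_in_unit[of s j] cf_prob_pos[of "Suc j" s] by (auto intro!: mult_nonneg_nonneg)

lemma sum_transfer_le:
  "0 \<le> s \<Longrightarrow> (\<Sum>j<n. cf_prob (Suc j) s * f (1 / (real (Suc j) + s))) \<le> 1 - (1 + s) / (real n + 1 + s)"
  unfolding sum_cf_prob[symmetric]
  by (intro sum_mono mult_left_le) (use apply_digit_in_unit[of s] cf_prob_pos[of _ s] in \<open>auto simp: less_imp_le\<close>)

lemma summable_transfer:
  assumes "0 \<le> s"
  shows "summable (\<lambda>j. cf_prob (Suc j) s * f (1 / (real (Suc j) + s)))"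
proof (rule summableI_nonneg_bounded[where x = 1])
  show "(\<Sum>j<n. cf_prob (Suc j) s * f (1 / (real (Suc j) + s))) \<le> 1" for n
  proof -
    have "0 \<le> (1 + s) / (real n + 1 + s)" using assms by simp
    then show ?thesis using sum_transfer_le[OF assms, of n] by linarith
  qed
qed (use transfer_term_nonneg assms in auto)

lemma sum_le_cf_transfer:
  assumes "0 \<le> s"
  shows "(\<Sum>j<n. cf_prob (Suc j) s * f (1 / (real (Suc j) + s))) \<le> cf_transfer f s"
  unfolding cf_transfer_def
  by (rule sum_le_suminf[OF summable_transfer[OF assms]])
     (simp, rule transfer_term_nonneg[OF assms])

lemma cf_transfer_in_unit:
  assumes "0 \<le> s"
  shows "cf_transfer f s \<in> {0..1}"
proof -
  have "cf_transfer f s \<le> 1" unfolding cf_transfer_def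
  proof (rule suminf_le_const[OF summable_transfer[OF assms]])
    fix n
    have "0 \<le> (1 + s) / (real n + 1 + s)" using assms by simp
    then show "(\<Sum>j<n. cf_prob (Suc j) s * f (1 / (real (Suc j) + s))) \<le> 1"
      using sum_transfer_le[OF assms, of n] by linarith
  qed
  then show ?thesis using sum_le_cf_transfer[OF assms, of 0] by simp
qed

text \<open>The digits above \<open>n\<close> have total mass (1+s)/(n+1+s). The bound is uniform in
  \<open>s\<close>, so integrals of the operator reduce to integrals of finite sums.\<close>

lemma cf_transfer_le_sum:
  assumes "s \<in> {0..1}"
  shows "cf_transfer f s \<le> (\<Sum>j<n. cf_prob (Suc j) s * f (1 / (real (Suc j) + s))) + 2 / (real n + 1)"
  unfolding cf_transfer_def
proof (rule suminf_le_const[OF summable_transfer])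
  let ?S = "\<lambda>n. \<Sum>j<n. cf_prob (Suc j) s * f (1 / (real (Suc j) + s))"
  have s: "0 \<le> s" using assms by simp
  have m: "?S i \<le> ?S j" if "i \<le> j" for i j
    using that by (intro sum_mono2 transfer_term_nonneg[OF s]) auto
  have tail: "(1 + s) / (real n + 1 + s) \<le> 2 / (real n + 1)"
    using assms by (intro frac_le) auto
  fix i
  show "?S i \<le> ?S n + 2 / (real n + 1)"
  proof (cases "i \<le> n")
    case True
    moreover have "0 \<le> 2 / (real n + 1)" by simp
    ultimately show ?thesis using m[of i n] by linarith
  next
    case False
    have "?S i - ?S n = (\<Sum>j\<in>{..<i} - {..<n}. cf_prob (Suc j) s * f (1 / (real (Suc j) + s)))"
      using False by (subst sum_diff) auto
    also have "\<dots> \<le> (\<Sum>j\<in>{..<i} - {..<n}. cf_prob (Suc j) s)"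
      using apply_digit_in_unit[OF s] cf_prob_pos[OF _ s] by (intro sum_mono mult_left_le) (auto simp: less_imp_le)
    also have "\<dots> = (\<Sum>j<i. cf_prob (Suc j) s) - (\<Sum>j<n. cf_prob (Suc j) s)"
      using False by (subst sum_diff) auto
    also have "\<dots> = (1 + s) / (real n + 1 + s) - (1 + s) / (real i + 1 + s)"
      unfolding sum_cf_prob[OF s] by simp
    also have "\<dots> \<le> (1 + s) / (real n + 1 + s)" using s by simp
    finally show ?thesis using tail by linarith
  qed
qed (use assms in simp)

text \<open>Moving the arguments of \<open>f\<close> with fixed weights costs 5/8, and moving the
  weights costs 1/4; together these make 7/8.\<close>

lemma cf_transfer_lipschitz:
  assumes L: "L-lipschitz_on {0..1} f"
  shows "(7 / 8 * L)-lipschitz_on {0..1} (cf_transfer f)"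
proof (rule lipschitz_onI)
  have L0: "0 \<le> L" using L by (rule lipschitz_on_nonneg)
  then show "0 \<le> 7 / 8 * L" by simp
  fix x y :: real assume xy: "x \<in> {0..1}" "y \<in> {0..1}"
  then have x0: "0 \<le> x" and y0: "0 \<le> y" by auto
  define u where "u z j = 1 / (real (Suc j) + z)" for z :: real and j
  define S where "S z n = (\<Sum>j<n. cf_prob (Suc j) z * f (u z j))" for z n
  \<comment> \<open>The change, between \<open>x\<close> and \<open>y\<close>, of the mass of the
    digits above \<open>n\<close>.\<close>
  define D where "D n = (1 + x) / (real n + 1 + x) - (1 + y) / (real n + 1 + y)" for n
  have lim: "S z \<longlonglongrightarrow> cf_transfer f z" if "0 \<le> z" for z
    unfolding S_def cf_transfer_def u_def using summable_transfer[OF that] summable_LIMSEQ by blast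
  have u01: "u z j \<in> {0..1}" if "0 \<le> z" for z j
    unfolding u_def by (rule inverse_digit_in_unit) (use that in auto)
  have fL: "\<bar>f a - f b\<bar> \<le> L * \<bar>a - b\<bar>" if "a \<in> {0..1}" "b \<in> {0..1}" for a b
    using lipschitz_onD[OF L that] by (simp add: dist_real_def)
  have D_eq: "D n = real n * (x - y) / ((real n + 1 + x) * (real n + 1 + y))" for n
  proof -
    have "real n + 1 + x > 0" "real n + 1 + y > 0" using x0 y0 by auto
    then show ?thesis unfolding D_def by (simp add: divide_simps) (simp add: algebra_simps)
  qed
  have D_abs: "\<bar>D n\<bar> \<le> real n / (real n + 1)\<^sup>2 * \<bar>x - y\<bar>" for n
  proof -
    have "\<bar>D n\<bar> = real n * \<bar>x - y\<bar> / ((real n + 1 + x) * (real n + 1 + y))"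
      unfolding D_eq using x0 y0 by (simp add: abs_mult)
    also have "\<dots> \<le> real n * \<bar>x - y\<bar> / ((real n + 1) * (real n + 1))"
      using x0 y0 by (intro divide_left_mono mult_mono mult_pos_pos) auto
    finally show ?thesis by (simp add: power2_eq_square)
  qed
  have pD: "cf_prob (Suc j) x - cf_prob (Suc j) y = D j - D (Suc j)" for j
  proof -
    have "cf_prob (Suc j) z = (1 + z) / (real j + 1 + z) - (1 + z) / (real (Suc j) + 1 + z)" if "0 \<le> z" for z
      using sum_cf_prob[OF that, of "Suc j"] sum_cf_prob[OF that, of j] by simp
    then show ?thesis using x0 y0 by (simp add: D_def)
  qed
  \<comment> \<open>The differences \<open>p\<^sub>k(x) - p\<^sub>k(y)\<close> telescope, so summing by parts lets them act on
    increments of \<open>f\<close>, which the Lipschitz constant controls.\<close>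
  have by_parts: "(\<Sum>j<n. (D j - D (Suc j)) * f (u y j)) =
      (\<Sum>j<n. D (Suc j) * (f (u y (Suc j)) - f (u y j))) - D n * f (u y n)" for n
  proof (induction n)
    case 0
    have "D 0 = 0" using x0 y0 by (simp add: D_eq)
    then show ?case by simp
  next
    case (Suc n)
    then show ?case by (simp add: algebra_simps)
  qed
  \<comment> \<open>The branch of digit 1 contracts by at most a factor 1 and has weight at most
    1/2; the other branches contract by 1/4. As the weights sum to at most 1, the total is at most
    1/4 + 3/4 * 1/2 = 5/8.\<close>
  have A: "\<bar>\<Sum>j<n. cf_prob (Suc j) x * (f (u x j) - f (u y j))\<bar> \<le> 5 / 8 * L * \<bar>x - y\<bar>" for n
  proof (cases n)
    case 0
    then show ?thesis using L0 by simp
  next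
    case (Suc n')
    let ?w = "\<lambda>j. if j = 0 then 1 else 1 / 4 :: real"
    have du: "\<bar>f (u x j) - f (u y j)\<bar> \<le> L * \<bar>x - y\<bar> * ?w j" for j
    proof -
      have pos: "real (Suc j) + x > 0" "real (Suc j) + y > 0" using x0 y0 by auto
      have "u x j - u y j = (y - x) / ((real (Suc j) + x) * (real (Suc j) + y))"
        unfolding u_def using pos by (simp add: divide_simps)
      then have "\<bar>u x j - u y j\<bar> = \<bar>x - y\<bar> * (1 / ((real (Suc j) + x) * (real (Suc j) + y)))"
        using pos by (simp add: abs_mult abs_minus_commute)
      also have "\<dots> \<le> \<bar>x - y\<bar> * ?w j"
      proof (intro mult_left_mono)
        have "1 * 1 \<le> (real (Suc j) + x) * (real (Suc j) + y)"
          using x0 y0 by (intro mult_mono) auto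
        moreover have "2 * 2 \<le> (real (Suc j) + x) * (real (Suc j) + y)" if "j \<noteq> 0"
          using x0 y0 that by (intro mult_mono) auto
        ultimately show "1 / ((real (Suc j) + x) * (real (Suc j) + y)) \<le> ?w j"
          using pos by (auto simp: divide_le_eq)
      qed simp
      finally have "L * \<bar>u x j - u y j\<bar> \<le> L * \<bar>x - y\<bar> * ?w j"
        using L0 by (simp add: mult_left_mono mult.assoc)
      then show ?thesis using fL[OF u01[OF x0] u01[OF y0], of j j] by linarith
    qed
    have "\<bar>\<Sum>j<n. cf_prob (Suc j) x * (f (u x j) - f (u y j))\<bar>
        \<le> (\<Sum>j<n. cf_prob (Suc j) x * (L * \<bar>x - y\<bar> * ?w j))"
    proof (intro order.trans[OF sum_abs] sum_mono)
      fix j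
      have "0 < cf_prob (Suc j) x" using cf_prob_pos[OF _ x0] by simp
      then show "\<bar>cf_prob (Suc j) x * (f (u x j) - f (u y j))\<bar> \<le> cf_prob (Suc j) x * (L * \<bar>x - y\<bar> * ?w j)"
        using mult_left_mono[OF du[of j], of "cf_prob (Suc j) x"] by (simp add: abs_mult)
    qed
    also have "\<dots> = L * \<bar>x - y\<bar> * (\<Sum>j<n. cf_prob (Suc j) x * ?w j)"
      by (simp add: sum_distrib_left algebra_simps)
    also have "\<dots> \<le> L * \<bar>x - y\<bar> * (5 / 8)"
    proof (rule mult_left_mono)
      have "(\<Sum>j<n. cf_prob (Suc j) x * ?w j) = (\<Sum>j<n. cf_prob (Suc j) x * (1/4) + (if j = 0 then 3/4 * cf_prob 1 x else 0))"
        by (intro sum.cong) auto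
      also have "\<dots> = (\<Sum>j<n. cf_prob (Suc j) x) * (1/4) + 3/4 * cf_prob 1 x"
        using Suc by (simp add: sum.distrib sum_distrib_right)
      also have "\<dots> \<le> 1 * (1/4) + 3/4 * (1/2)"
        using cf_prob_le_half[of 1 x] cf_prob_pos[of 1 x] xy x0
        by (intro add_mono mult_mono) (auto simp: sum_cf_prob)
      finally show "(\<Sum>j<n. cf_prob (Suc j) x * ?w j) \<le> 5 / 8" by simp
    qed (use L0 in simp)
    finally show ?thesis by (simp add: algebra_simps)
  qed
  \<comment> \<open>With k = j+1 the product of the two bounds is 1/(k+1)^3, which is at most
    1/(k(k+1)(k+2)). This is half of the telescoping term \<open>?t j\<close>, and the sum over all
    k is 1/4.\<close>
  have B: "\<bar>\<Sum>j<n. D (Suc j) * (f (u y (Suc j)) - f (u y j))\<bar> \<le> 1 / 4 * L * \<bar>x - y\<bar>" for n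
  proof -
    let ?t = "\<lambda>j. 1 / ((real j + 1) * (real j + 2)) - 1 / ((real j + 2) * (real j + 3))"
    have du: "\<bar>D (Suc j) * (f (u y (Suc j)) - f (u y j))\<bar> \<le> L * \<bar>x - y\<bar> * (?t j / 2)" for j
    proof -
      define k where "k = real j + 1"
      have k1: "k \<ge> 1" by (simp add: k_def)
      have uy: "u y j = 1 / (k + y)" "u y (Suc j) = 1 / (k + 1 + y)" by (auto simp: u_def k_def algebra_simps)
      have "\<bar>u y (Suc j) - u y j\<bar> = 1 / ((k + y) * (k + 1 + y))"
        unfolding uy using k1 y0 by (simp add: divide_simps)
      also have "\<dots> \<le> 1 / (k * (k + 1))"
        using k1 y0 by (intro divide_left_mono mult_mono mult_pos_pos) auto
      finally have "\<bar>f (u y (Suc j)) - f (u y j)\<bar> \<le> L * (1 / (k * (k + 1)))"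
        using fL[OF u01[OF y0] u01[OF y0], of "Suc j" j] L0
        by (meson mult_left_mono order_trans)
      moreover have "\<bar>D (Suc j)\<bar> \<le> k / (k + 1)\<^sup>2 * \<bar>x - y\<bar>"
        using D_abs[of "Suc j"] by (simp add: k_def algebra_simps)
      ultimately have "\<bar>D (Suc j) * (f (u y (Suc j)) - f (u y j))\<bar> \<le> (k / (k + 1)\<^sup>2 * \<bar>x - y\<bar>) * (L * (1 / (k * (k + 1))))"
        unfolding abs_mult using k1 by (intro mult_mono) auto
      also have "\<dots> = L * \<bar>x - y\<bar> * (1 / (k + 1) ^ 3)"
        using k1 by (simp add: power2_eq_square power3_eq_cube mult_ac)
      also have "\<dots> \<le> L * \<bar>x - y\<bar> * (?t j / 2)"
      proof (intro mult_left_mono)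
        have "?t j / 2 = 1 / (k * (k + 1) * (k + 2))"
          by (simp add: k_def divide_simps) (simp add: algebra_simps)
        moreover have "1 / (k + 1) ^ 3 \<le> 1 / (k * (k + 1) * (k + 2))"
          using k1 by (intro divide_left_mono) (auto simp: power3_eq_cube algebra_simps intro!: mult_pos_pos add_pos_pos)
        ultimately show "1 / (k + 1) ^ 3 \<le> ?t j / 2" by simp
      qed (use L0 in simp)
      finally show ?thesis .
    qed
    have tele: "(\<Sum>j<n. ?t j) = 1/2 - 1 / ((real n + 1) * (real n + 2))"
      by (induction n) (auto simp: algebra_simps)
    have "\<bar>\<Sum>j<n. D (Suc j) * (f (u y (Suc j)) - f (u y j))\<bar> \<le> (\<Sum>j<n. L * \<bar>x - y\<bar> * (?t j / 2))"
      using du by (intro order.trans[OF sum_abs] sum_mono) auto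
    also have "\<dots> = L * \<bar>x - y\<bar> * ((\<Sum>j<n. ?t j) / 2)"
      by (simp add: sum_distrib_left sum_divide_distrib)
    also have "\<dots> \<le> L * \<bar>x - y\<bar> * ((1/2) / 2)"
      unfolding tele using L0 by (intro mult_left_mono divide_right_mono) auto
    finally show ?thesis by (simp add: algebra_simps)
  qed
  \<comment> \<open>The summand 1/(n+1) pays for the boundary term of the summation by parts and
    disappears in the limit.\<close>
  have main: "\<bar>S x n - S y n\<bar> \<le> 7 / 8 * L * \<bar>x - y\<bar> + inverse (real (Suc n))" for n
  proof -
    have "S x n - S y n = (\<Sum>j<n. cf_prob (Suc j) x * (f (u x j) - f (u y j)))
        + (\<Sum>j<n. (cf_prob (Suc j) x - cf_prob (Suc j) y) * f (u y j))"
      by (simp add: S_def sum_subtractf[symmetric] sum.distrib[symmetric] algebra_simps)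
    also have "\<dots> = (\<Sum>j<n. cf_prob (Suc j) x * (f (u x j) - f (u y j)))
        + (\<Sum>j<n. D (Suc j) * (f (u y (Suc j)) - f (u y j))) - D n * f (u y n)"
      unfolding pD by_parts by simp
    finally have eq: "S x n - S y n = \<dots>" .
    have "\<bar>D n * f (u y n)\<bar> \<le> (real n / (real n + 1)\<^sup>2 * \<bar>x - y\<bar>) * 1"
      unfolding abs_mult using D_abs[of n] f01 u01[OF y0, of n] by (intro mult_mono) (auto simp: Pi_iff)
    also have "\<dots> \<le> real n / (real n + 1)\<^sup>2"
    proof -
      have "\<bar>x - y\<bar> \<le> 1" using xy by auto
      then show ?thesis by (simp add: mult_left_le divide_right_mono)
    qed
    also have "\<dots> \<le> inverse (real (Suc n))"
      by (simp add: divide_simps power2_eq_square) (simp add: algebra_simps)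
    finally show ?thesis unfolding eq using A[of n] B[of n] by linarith
  qed
  have l1: "(\<lambda>n. \<bar>S x n - S y n\<bar>) \<longlonglongrightarrow> \<bar>cf_transfer f x - cf_transfer f y\<bar>"
    using lim[OF x0] lim[OF y0] by (intro tendsto_intros)
  have l2: "(\<lambda>n. 7 / 8 * L * \<bar>x - y\<bar> + inverse (real (Suc n))) \<longlonglongrightarrow> 7 / 8 * L * \<bar>x - y\<bar> + 0"
    by (intro tendsto_intros LIMSEQ_inverse_real_of_nat)
  have "\<bar>cf_transfer f x - cf_transfer f y\<bar> \<le> 7 / 8 * L * \<bar>x - y\<bar> + 0"
    by (rule LIMSEQ_le[OF l1 l2]) (use main in blast)
  then show "dist (cf_transfer f x) (cf_transfer f y) \<le> 7 / 8 * L * dist x y"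
    by (simp add: dist_real_def)
qed

end

text \<open>The substitution u = 1/(j+1+s) turns the j-th term into the integral of f(u)/(1+u) from
  1/(j+2) to 1/(j+1), and these intervals tile (0,1]. This is one half of the invariance of the
  Gauss measure.\<close>

lemma integral_cf_transfer_le:
  assumes f01: "f \<in> {0..1} \<rightarrow> {0..1}" and L: "L-lipschitz_on {0..1} f"
  shows "integral {0..1} (\<lambda>s. cf_transfer f s / (1 + s)) \<le> integral {0..1} (\<lambda>s. f s / (1 + s))"
proof -
  define h where "h t = f t / (1 + t)" for t
  define \<Phi> where "\<Phi> t = integral {0..t} h" for t
  have cont: "continuous_on {0..1} h"
    unfolding h_def by (intro continuous_intros lipschitz_on_continuous_on[OF L]) auto
  have h0: "0 \<le> h t" if "t \<in> {0..1}" for t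
    using f01 that by (auto simp: h_def Pi_iff)
  have d\<Phi>: "(\<Phi> has_vector_derivative h t) (at t within {0..1})" if "t \<in> {0..1}" for t
    unfolding \<Phi>_def using integral_has_vector_derivative[OF cont that] .
  have \<Phi>_nonneg: "0 \<le> \<Phi> t" if "t \<in> {0..1}" for t
    unfolding \<Phi>_def using that h0
    by (intro integral_nonneg integrable_continuous_interval continuous_on_subset[OF cont]) auto
  define u where "u j s = 1 / (real (Suc j) + s)" for j s
  have u01: "u j s \<in> {0..1}" if "s \<in> {0..1}" for j s
    unfolding u_def by (rule inverse_digit_in_unit) (use that in auto)
  have branch: "((\<lambda>s. cf_prob (Suc j) s * f (u j s) / (1 + s)) has_integral
      \<Phi> (1 / real (Suc j)) - \<Phi> (1 / real (Suc (Suc j)))) {0..1}" for j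
  proof -
    have "((\<lambda>s. cf_prob (Suc j) s * f (u j s) / (1 + s)) has_integral
        (- \<Phi> (u j 1)) - (- \<Phi> (u j 0))) {0..1}"
    proof (rule fundamental_theorem_of_calculus)
      fix s :: real assume s: "s \<in> {0..1}"
      have p: "real (Suc j) + s > 0" using s by auto
      have du: "(u j has_vector_derivative (- 1 / (real (Suc j) + s)\<^sup>2)) (at s within {0..1})"
        unfolding u_def has_real_derivative_iff_has_vector_derivative[symmetric]
        using p by (auto intro!: derivative_eq_intros simp: power2_eq_square)
      have "(\<Phi> \<circ> u j has_vector_derivative (- 1 / (real (Suc j) + s)\<^sup>2) *\<^sub>R h (u j s)) (at s within {0..1})"
        by (rule vector_diff_chain_within[OF du])
           (rule has_vector_derivative_within_subset[OF d\<Phi>], use u01 s in auto)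
      then have "((\<lambda>s. - \<Phi> (u j s)) has_vector_derivative
          - ((- 1 / (real (Suc j) + s)\<^sup>2) *\<^sub>R h (u j s))) (at s within {0..1})"
        by (intro derivative_intros) (simp add: o_def)
      moreover have "- ((- 1 / (real (Suc j) + s)\<^sup>2) *\<^sub>R h (u j s)) = cf_prob (Suc j) s * f (u j s) / (1 + s)"
      proof -
        define k where "k = real (Suc j)"
        have k: "k \<ge> 1" by (simp add: k_def)
        have "1 + 1 / (k + s) = (k + 1 + s) / (k + s)" using k s by (simp add: field_simps)
        then have "h (1 / (k + s)) = f (1 / (k + s)) * (k + s) / (k + 1 + s)"
          by (simp add: h_def)
        then show ?thesis using k s
          unfolding u_def cf_prob_def k_def[symmetric] by (simp add: power2_eq_square)
      qed
      ultimately show "((\<lambda>s. - \<Phi> (u j s)) has_vector_derivative cf_prob (Suc j) s * f (u j s) / (1 + s))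
          (at s within {0..1})" by simp
    qed simp
    then show ?thesis by (simp add: u_def add.commute)
  qed
  have total: "((\<lambda>s. \<Sum>j<n. cf_prob (Suc j) s * f (u j s) / (1 + s)) has_integral
      \<Phi> 1 - \<Phi> (1 / real (Suc n))) {0..1}" for n
  proof -
    have "((\<lambda>s. \<Sum>j<n. cf_prob (Suc j) s * f (u j s) / (1 + s)) has_integral
        (\<Sum>j<n. \<Phi> (1 / real (Suc j)) - \<Phi> (1 / real (Suc (Suc j))))) {0..1}"
      by (intro has_integral_sum branch) auto
    also have "(\<Sum>j<n. \<Phi> (1 / real (Suc j)) - \<Phi> (1 / real (Suc (Suc j)))) = \<Phi> 1 - \<Phi> (1 / real (Suc n))"
      by (subst sum_lessThan_telescope') simp
    finally show ?thesis .
  qed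
  have cT: "continuous_on {0..1} (\<lambda>s. cf_transfer f s / (1 + s))"
    by (intro continuous_intros lipschitz_on_continuous_on[OF cf_transfer_lipschitz[OF f01 L]]) auto
  \<comment> \<open>Only finitely many branches are integrated; the tail is at most 2/(n+1) and the
    nonnegative remainder near 0 is dropped.\<close>
  have bound: "integral {0..1} (\<lambda>s. cf_transfer f s / (1 + s)) \<le> \<Phi> 1 + 2 / (real n + 1)" for n
  proof -
    have "integral {0..1} (\<lambda>s. cf_transfer f s / (1 + s)) \<le> (\<Phi> 1 - \<Phi> (1 / real (Suc n))) + 2 / (real n + 1)"
    proof (rule has_integral_le[OF integrable_integral has_integral_add[OF total]])
      show "(\<lambda>s. cf_transfer f s / (1 + s)) integrable_on {0..1}"
        by (rule integrable_continuous_interval[OF cT])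
      show "((\<lambda>s::real. 2 / (real n + 1)) has_integral 2 / (real n + 1)) {0..1}"
        using has_integral_const_real[of "2 / (real n + 1)" 0 1] by simp
      fix s :: real assume s: "s \<in> {0..1}"
      have "cf_transfer f s / (1 + s) \<le> ((\<Sum>j<n. cf_prob (Suc j) s * f (u j s)) + 2 / (real n + 1)) / (1 + s)"
        using cf_transfer_le_sum[OF f01 s, of n] s by (intro divide_right_mono) (auto simp: u_def)
      also have "\<dots> = (\<Sum>j<n. cf_prob (Suc j) s * f (u j s) / (1 + s)) + 2 / (real n + 1) / (1 + s)"
        by (simp add: add_divide_distrib sum_divide_distrib)
      also have "2 / (real n + 1) / (1 + s) \<le> 2 / (real n + 1) / 1"
        using s by (intro divide_left_mono) auto
      finally show "cf_transfer f s / (1 + s) \<le>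
          (\<Sum>j<n. cf_prob (Suc j) s * f (u j s) / (1 + s)) + 2 / (real n + 1)" by simp
    qed
    moreover have "0 \<le> \<Phi> (1 / real (Suc n))" by (rule \<Phi>_nonneg) auto
    ultimately show ?thesis by linarith
  qed
  have "(\<lambda>n. \<Phi> 1 + 2 * inverse (real (Suc n))) \<longlonglongrightarrow> \<Phi> 1 + 2 * 0"
    by (intro tendsto_intros LIMSEQ_inverse_real_of_nat)
  then have "integral {0..1} (\<lambda>s. cf_transfer f s / (1 + s)) \<le> \<Phi> 1 + 2 * 0"
    by (rule LIMSEQ_le_const) (use bound in \<open>auto simp: divide_inverse add.commute\<close>)
  then show ?thesis by (simp add: \<Phi>_def h_def[abs_def])
qed

text \<open>The three properties are carried together: contraction needs the range, and comparing
  integrals needs both.\<close>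

lemma cf_transfer_iterate:
  assumes f01: "f \<in> {0..1} \<rightarrow> {0..1}" and L: "L-lipschitz_on {0..1} f"
  shows "(cf_transfer ^^ g) f \<in> {0..1} \<rightarrow> {0..1} \<and>
    ((7 / 8) ^ g * L)-lipschitz_on {0..1} ((cf_transfer ^^ g) f) \<and>
    integral {0..1} (\<lambda>s. (cf_transfer ^^ g) f s / (1 + s)) \<le> integral {0..1} (\<lambda>s. f s / (1 + s))"
proof (induction g)
  case (Suc g)
  let ?F = "(cf_transfer ^^ g) f"
  have F: "?F \<in> {0..1} \<rightarrow> {0..1}" "((7 / 8) ^ g * L)-lipschitz_on {0..1} ?F" using Suc by auto
  have "cf_transfer ?F \<in> {0..1} \<rightarrow> {0..1}"
    using cf_transfer_in_unit[OF F(1)] by auto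
  moreover have "((7 / 8) ^ Suc g * L)-lipschitz_on {0..1} (cf_transfer ?F)"
    using cf_transfer_lipschitz[OF F] by (simp add: mult.assoc)
  ultimately show ?case
    using integral_cf_transfer_le[OF F] Suc by auto
qed (use assms in auto)

text \<open>The Gauss measure of the cylinder of \<open>w\<close> in closed form, from the
  distribution function ln(1+x)/ln 2 at the ends of the cylinder; the sign corrects the
  orientation.\<close>

definition gauss_word :: "nat list \<Rightarrow> real" where
  "gauss_word w = (-1) ^ length w * (ln (1 + cf_branch w 1) - ln (1 + cf_branch w 0)) / ln 2"

text \<open>Since \<open>cond_cdf s x / (1 + s)\<close> equals x/(1+sx), its integral over
  \<open>s\<close> is ln(1+x). Thus the conditional measures, mixed over a Gauss distributed
  \<open>s\<close>, give back the Gauss measure.\<close>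

lemma has_integral_word_prob:
  assumes "\<forall>k\<in>set w. 1 \<le> k"
  shows "((\<lambda>s. word_prob w s / (1 + s)) has_integral gauss_word w * ln 2) {0..1}"
proof -
  let ?F = "\<lambda>x s. ln (1 + s * x)"
  have br: "cf_branch w y \<in> {0..1}" if "y \<in> {0..1}" for y
    by (rule cf_branch_in_unit[OF assms that])
  have dF: "((\<lambda>s. cond_cdf s x / (1 + s)) has_integral ?F x 1 - ?F x 0) {0..1}" if x: "x \<in> {0..1}" for x
  proof (rule fundamental_theorem_of_calculus)
    fix s :: real assume s: "s \<in> {0..1}"
    have "1 + s * x > 0" using s x by (intro add_pos_nonneg) auto
    then show "(?F x has_vector_derivative cond_cdf s x / (1 + s)) (at s within {0..1})"
      unfolding has_real_derivative_iff_has_vector_derivative[symmetric]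
      using s by (auto intro!: derivative_eq_intros simp: cond_cdf_def)
  qed simp
  have "((\<lambda>s. (-1) ^ length w * (cond_cdf s (cf_branch w 1) / (1 + s) - cond_cdf s (cf_branch w 0) / (1 + s)))
      has_integral (-1) ^ length w * ((?F (cf_branch w 1) 1 - ?F (cf_branch w 1) 0)
        - (?F (cf_branch w 0) 1 - ?F (cf_branch w 0) 0))) {0..1}"
    by (intro has_integral_mult_right has_integral_diff dF br) auto
  moreover have "(-1) ^ length w * (cond_cdf s (cf_branch w 1) / (1 + s) - cond_cdf s (cf_branch w 0) / (1 + s))
     = word_prob w s / (1 + s)" if "s \<in> {0..1}" for s
    using that by (simp add: word_prob_eq_cond_cdf[OF assms] diff_divide_distrib right_diff_distrib)
  ultimately have "((\<lambda>s. word_prob w s / (1 + s)) has_integral (-1) ^ length w * ((?F (cf_branch w 1) 1 - ?F (cf_branch w 1) 0)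
        - (?F (cf_branch w 0) 1 - ?F (cf_branch w 0) 0))) {0..1}"
    by (rule has_integral_eq[rotated])
  then show ?thesis by (simp add: gauss_word_def)
qed

lemma word_prob_range:
  assumes "\<forall>k\<in>set w. 1 \<le> k"
  shows "word_prob w \<in> {0..1} \<rightarrow> {0..1}"
  using word_prob_le_1[OF assms] word_prob_pos[OF assms] by (force simp: less_imp_le)

text \<open>After \<open>g\<close> steps the Gauss mean is still at most
  \<open>gauss_word w\<close>, while the oscillation is at most 2(7/8)^g. A function exceeds its
  mean by at most its oscillation.\<close>

lemma cf_transfer_word_prob_le:
  assumes w: "\<forall>k\<in>set w. 1 \<le> k" and s: "s \<in> {0..1}"
  shows "(cf_transfer ^^ g) (word_prob w) s \<le> gauss_word w + 2 * (7 / 8) ^ g"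
proof -
  let ?F = "(cf_transfer ^^ g) (word_prob w)"
  \<comment> \<open>A lower bound for \<open>?F\<close> on all of [0,1], by the Lipschitz
    constant.\<close>
  define c where "c = ?F s - 2 * (7 / 8) ^ g"
  note it = cf_transfer_iterate[OF word_prob_range[OF w] word_prob_lipschitz[OF w], of g]
  have cT: "continuous_on {0..1} (\<lambda>s. ?F s / (1 + s))"
    using it by (intro continuous_intros lipschitz_on_continuous_on[of "(7 / 8) ^ g * 2"]) auto
  have c: "((\<lambda>t. c * (1 / (1 + t))) has_integral c * (ln (1 + 1) - ln (1 + 0))) {0..1}"
    by (intro has_integral_mult_right fundamental_theorem_of_calculus)
       (auto simp: has_real_derivative_iff_has_vector_derivative[symmetric] intro!: derivative_eq_intros)
  have "c * (ln (1 + 1) - ln (1 + 0)) \<le> integral {0..1} (\<lambda>s. ?F s / (1 + s))"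
  proof (rule has_integral_le[OF c integrable_integral[OF integrable_continuous_interval[OF cT]]])
    fix t :: real assume t: "t \<in> {0..1}"
    have "dist (?F s) (?F t) \<le> (7 / 8) ^ g * 2 * dist s t"
      using it s t by (intro lipschitz_onD) auto
    also have "\<dots> \<le> (7 / 8) ^ g * 2 * 1"
      using s t by (intro mult_left_mono) (auto simp: dist_real_def)
    finally have "c \<le> ?F t" by (auto simp: c_def dist_real_def)
    then show "c * (1 / (1 + t)) \<le> ?F t / (1 + t)" using t by (simp add: divide_right_mono)
  qed
  also have "\<dots> \<le> gauss_word w * ln 2"
    using it integral_unique[OF has_integral_word_prob[OF w]] by simp
  finally show ?thesis by (simp add: c_def)
qed

text \<open>At \<open>s = 0\<close> the conditional density is 1, so this is the Lebesgue length of
  the cylinder.\<close>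

lemma word_prob_zero:
  assumes "\<forall>k\<in>set w. 1 \<le> k"
  shows "word_prob w 0 = (-1) ^ length w * (cf_branch w 1 - cf_branch w 0)"
  by (simp add: word_prob_eq_cond_cdf[OF assms] cond_cdf_def)

lemma cf_branch_order:
  assumes "\<forall>k\<in>set w. 1 \<le> k"
  shows "even (length w) \<Longrightarrow> cf_branch w 0 < cf_branch w 1"
    and "odd (length w) \<Longrightarrow> cf_branch w 1 < cf_branch w 0"
  using word_prob_zero[OF assms] word_prob_pos[OF assms, of 0] by auto

lemma ln_diff_bounds:
  assumes "0 \<le> a" "a \<le> b" "b \<le> (1::real)"
  shows "ln (1 + b) - ln (1 + a) \<le> b - a" "(b - a) / 2 \<le> ln (1 + b) - ln (1 + a)"
proof -
  have e: "ln (1 + b) - ln (1 + a) = ln ((1 + b) / (1 + a))"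
    using assms by (subst ln_div) auto
  have "ln ((1 + b) / (1 + a)) \<le> (1 + b) / (1 + a) - 1"
    using assms by (intro ln_le_minus_one) auto
  also have "\<dots> = (b - a) / (1 + a)" using assms by (simp add: field_simps)
  also have "\<dots> \<le> (b - a) / 1" using assms by (intro divide_left_mono) auto
  finally show "ln (1 + b) - ln (1 + a) \<le> b - a" unfolding e by simp
  have e': "ln (1 + b) - ln (1 + a) = - ln ((1 + a) / (1 + b))"
    using assms by (subst ln_div) auto
  have "ln ((1 + a) / (1 + b)) \<le> (1 + a) / (1 + b) - 1"
    using assms by (intro ln_le_minus_one) auto
  moreover have "(1 + a) / (1 + b) - 1 = - ((b - a) / (1 + b))" using assms by (simp add: field_simps)
  moreover have "(b - a) / 2 \<le> (b - a) / (1 + b)" using assms by (intro divide_left_mono) auto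
  ultimately show "(b - a) / 2 \<le> ln (1 + b) - ln (1 + a)" unfolding e' by linarith
qed

text \<open>The Gauss density lies between 1/(2 ln 2) and 1/ln 2, so Gauss measure and length are
  comparable.\<close>

lemma gauss_word_bounds:
  assumes "\<forall>k\<in>set w. 1 \<le> k"
  shows "gauss_word w \<le> word_prob w 0 / ln 2" "word_prob w 0 / (2 * ln 2) \<le> gauss_word w"
proof -
  have b: "cf_branch w 0 \<in> {0..1}" "cf_branch w 1 \<in> {0..1}"
    using cf_branch_in_unit[OF assms] by auto
  define D where "D = (-1) ^ length w * (ln (1 + cf_branch w 1) - ln (1 + cf_branch w 0))"
  have "D \<le> word_prob w 0 \<and> word_prob w 0 / 2 \<le> D"
    using cf_branch_order[OF assms] b ln_diff_bounds[of "cf_branch w 0" "cf_branch w 1"]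
      ln_diff_bounds[of "cf_branch w 1" "cf_branch w 0"]
    by (cases "even (length w)") (auto simp: word_prob_zero[OF assms] D_def)
  then show "gauss_word w \<le> word_prob w 0 / ln 2" "word_prob w 0 / (2 * ln 2) \<le> gauss_word w"
    using divide_right_mono[of D "word_prob w 0" "ln 2"] divide_right_mono[of "word_prob w 0 / 2" D "ln 2"]
    by (auto simp: gauss_word_def D_def)
qed

section \<open>The Gauss measure of cylinders\<close>

lemma cf_cylinder_Nil [simp]: "cf_cylinder [] = cf_X"
  by (simp add: cf_cylinder_def)

lemma cf_T_mem: "y \<in> cf_X \<Longrightarrow> cf_T y \<in> cf_X"
  using cf_T_in_X[of y 1] by simp

lemma cf_cylinder_Cons:
  "y \<in> cf_cylinder (k # w) \<longleftrightarrow> y \<in> cf_X \<and> y \<noteq> 0 \<and> \<lfloor>1 / y\<rfloor> = int k \<and> cf_T y \<in> cf_cylinder w"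
  by (auto simp: cf_cylinder_def All_less_Suc2 funpow_swap1 cf_T_mem)

lemma digit_expansion:
  assumes "y \<noteq> 0" "\<lfloor>1 / y\<rfloor> = int k"
  shows "y = 1 / (real k + cf_T y)"
  using assms by (simp add: cf_T_def)

text \<open>Induction along the order-reversing map z to 1/(k+z). Membership of the two end points
  varies with the word, so they are excluded; this costs no measure.\<close>

lemma cf_cylinder_iff_between:
  assumes "\<forall>k\<in>set w. 1 \<le> k" "y \<noteq> cf_branch w 0" "y \<noteq> cf_branch w 1"
  shows "y \<in> cf_cylinder w \<longleftrightarrow>
    (cf_branch w 0 < y \<and> y < cf_branch w 1) \<or> (cf_branch w 1 < y \<and> y < cf_branch w 0)"
  using assms
proof (induction w arbitrary: y)
  case Nil
  then show ?case by (auto simp: cf_X_def)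
next
  case (Cons k w)
  have k: "1 \<le> real k" using Cons.prems by auto
  have b: "0 \<le> cf_branch w 0" "0 \<le> cf_branch w 1" "cf_branch w 0 \<le> 1" "cf_branch w 1 \<le> 1"
    using cf_branch_in_unit[of w 0] cf_branch_in_unit[of w 1] Cons.prems by auto
  have anti: "1 / (real k + c) < 1 / (real k + d) \<longleftrightarrow> d < c" if "0 \<le> c" "0 \<le> d" for c d
    using k that by (auto simp: divide_simps)
  show ?case
  proof
    assume y: "y \<in> cf_cylinder (k # w)"
    define z where "z = cf_T y"
    have z: "z \<in> cf_cylinder w" "y = 1 / (real k + z)" "0 \<le> z"
      using y digit_expansion[of y k] cf_T_mem[of y] by (auto simp: cf_cylinder_Cons z_def cf_X_def)
    then have "z \<noteq> cf_branch w 0" "z \<noteq> cf_branch w 1" using Cons.prems by auto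
    then have "(cf_branch w 0 < z \<and> z < cf_branch w 1) \<or> (cf_branch w 1 < z \<and> z < cf_branch w 0)"
      using Cons.IH[of z] z Cons.prems by auto
    then show "(cf_branch (k # w) 0 < y \<and> y < cf_branch (k # w) 1) \<or>
        (cf_branch (k # w) 1 < y \<and> y < cf_branch (k # w) 0)"
      using anti b z by auto
  next
    assume *: "(cf_branch (k # w) 0 < y \<and> y < cf_branch (k # w) 1) \<or>
        (cf_branch (k # w) 1 < y \<and> y < cf_branch (k # w) 0)"
    \<comment> \<open>The only candidate for \<open>cf_T y\<close>; it is the right one once 0 < z <
      1 shows that the first digit is \<open>k\<close>.\<close>
    define z where "z = 1 / y - real k"
    have pos: "0 < 1 / (real k + c) \<and> 1 / (real k + c) \<le> 1" if "0 \<le> c" for c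
      using k that by (auto simp: divide_simps)
    have y: "0 < y" "y < 1"
      using *[unfolded cf_branch.simps] pos[OF b(1)] pos[OF b(2)] by linarith+
    have lt: "1 / (real k + c) < y \<longleftrightarrow> z < c" "y < 1 / (real k + c) \<longleftrightarrow> c < z" if "0 \<le> c" for c
      using k y that by (auto simp: z_def field_simps)
    have bet: "(cf_branch w 0 < z \<and> z < cf_branch w 1) \<or> (cf_branch w 1 < z \<and> z < cf_branch w 0)"
      using * lt[OF b(1)] lt[OF b(2)] by auto
    then have z: "z \<in> cf_cylinder w" using Cons.IH[of z] Cons.prems by auto
    have z01: "0 < z" "z < 1" using bet b by auto
    have "\<lfloor>1 / y\<rfloor> = int k" using z01 unfolding z_def by linarith
    moreover have "cf_T y = z" using y calculation by (simp add: cf_T_def z_def)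
    ultimately show "y \<in> cf_cylinder (k # w)"
      using y z by (simp add: cf_cylinder_Cons cf_X_def)
  qed
qed

lemma space_gauss_measure: "space gauss_measure = cf_X"
  by (simp add: gauss_measure_def space_restrict_space)

lemma sets_gauss_measure: "sets gauss_measure = sets (restrict_space lborel cf_X)"
  by (simp add: gauss_measure_def)

lemma cf_X_borel [measurable]: "cf_X \<in> sets borel"
  by (simp add: cf_X_def)

lemma sets_gauss_measure_iff: "A \<in> sets gauss_measure \<longleftrightarrow> A \<subseteq> cf_X \<and> A \<in> sets borel"
  by (auto simp: sets_gauss_measure sets_restrict_space_iff)

lemma emeasure_gauss_measure:
  assumes "A \<in> sets gauss_measure"
  shows "emeasure gauss_measure A = (\<integral>\<^sup>+x. ennreal (1 / ln 2 * (1 / (1 + x))) * indicator A x \<partial>lborel)"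
proof -
  have A: "A \<subseteq> cf_X" "A \<in> sets borel" using assms by (auto simp: sets_gauss_measure_iff)
  have "emeasure gauss_measure A =
      (\<integral>\<^sup>+x. ennreal (1 / ln 2 * (1 / (1 + x))) * indicator A x \<partial>restrict_space lborel cf_X)"
    unfolding gauss_measure_def
    by (rule emeasure_density) (use assms in \<open>auto simp: sets_gauss_measure intro!: measurable_restrict_space1\<close>)
  also have "\<dots> = (\<integral>\<^sup>+x. ennreal (1 / ln 2 * (1 / (1 + x))) * indicator A x * indicator cf_X x \<partial>lborel)"
    by (rule nn_integral_restrict_space) simp
  also have "\<dots> = (\<integral>\<^sup>+x. ennreal (1 / ln 2 * (1 / (1 + x))) * indicator A x \<partial>lborel)"
    using A by (intro nn_integral_cong) (auto split: split_indicator)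
  finally show ?thesis .
qed

lemma cf_cylinder_sets:
  assumes "\<forall>k\<in>set w. 1 \<le> k"
  shows "cf_cylinder w \<in> sets cf_borel"
proof (cases "w = []")
  case True
  then show ?thesis using sets.top[of cf_borel] by (simp add: space_cf_borel)
next
  case False
  then show ?thesis using assms unfolding sets_cf_borel cf_cylinders_def
    by (intro sigma_sets.Basic) auto
qed

lemma emeasure_cf_cylinder:
  assumes w: "\<forall>k\<in>set w. 1 \<le> k"
  shows "emeasure gauss_measure (cf_cylinder w) = ennreal (gauss_word w)"
proof -
  \<comment> \<open>Taking minimum and maximum removes the parity of the length from the
    interval.\<close>
  define a where "a = min (cf_branch w 0) (cf_branch w 1)"
  define b where "b = max (cf_branch w 0) (cf_branch w 1)"
  have br: "cf_branch w 0 \<in> {0..1}" "cf_branch w 1 \<in> {0..1}"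
    using cf_branch_in_unit[OF w] by auto
  then have ab: "0 \<le> a" "a \<le> b" by (auto simp: a_def b_def)
  have AE: "AE x in lborel. x \<noteq> cf_branch w 0 \<and> x \<noteq> cf_branch w 1"
    using AE_lborel_singleton[of "cf_branch w 0"] AE_lborel_singleton[of "cf_branch w 1"]
    by eventually_elim auto
  have "emeasure gauss_measure (cf_cylinder w) =
      (\<integral>\<^sup>+x. ennreal (1 / ln 2 * (1 / (1 + x))) * indicator (cf_cylinder w) x \<partial>lborel)"
    by (rule emeasure_gauss_measure) (use cf_cylinder_sets[OF w] sets_cf_borel_subset in auto)
  also have "\<dots> = (\<integral>\<^sup>+x. ennreal (1 / ln 2 * (1 / (1 + x))) * indicator {a..b} x \<partial>lborel)"
  proof (rule nn_integral_cong_AE)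
    show "AE x in lborel. ennreal (1 / ln 2 * (1 / (1 + x))) * indicator (cf_cylinder w) x =
        ennreal (1 / ln 2 * (1 / (1 + x))) * indicator {a..b} x"
      using AE
    proof eventually_elim
      case (elim x)
      then have "x \<in> cf_cylinder w \<longleftrightarrow> x \<in> {a..b}"
        using cf_cylinder_iff_between[OF w, of x] by (auto simp: a_def b_def)
      then show ?case by (simp add: indicator_def)
    qed
  qed
  also have "\<dots> = ennreal (ln (1 + b) / ln 2 - ln (1 + a) / ln 2)"
  proof (rule nn_integral_FTC_Icc)
    fix x assume "x \<in> {a..b}"
    then show "((\<lambda>x. ln (1 + x) / ln 2) has_real_derivative 1 / ln 2 * (1 / (1 + x))) (at x)"
      using ab by (auto intro!: derivative_eq_intros)
    show "0 \<le> 1 / ln 2 * (1 / (1 + x))" using \<open>x \<in> {a..b}\<close> ab by auto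
  qed (use ab in auto)
  also have "ln (1 + b) / ln 2 - ln (1 + a) / ln 2 = gauss_word w"
    using cf_branch_order[OF w]
    by (cases "even (length w)") (auto simp: gauss_word_def a_def b_def diff_divide_distrib min_def max_def)
  finally show ?thesis .
qed

lemma gauss_word_pos:
  assumes "\<forall>k\<in>set w. 1 \<le> k"
  shows "0 < gauss_word w"
proof -
  have "0 < word_prob w 0 / (2 * ln 2)" using word_prob_pos[OF assms, of 0] by simp
  then show ?thesis using gauss_word_bounds(2)[OF assms] by linarith
qed

lemma measure_cf_cylinder:
  assumes "\<forall>k\<in>set w. 1 \<le> k"
  shows "measure gauss_measure (cf_cylinder w) = gauss_word w"
  using emeasure_cf_cylinder[OF assms] gauss_word_pos[OF assms] by (simp add: measure_def)

lemma prob_space_gauss_measure: "prob_space gauss_measure"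
proof
  have "emeasure gauss_measure cf_X = ennreal (gauss_word [])"
    using emeasure_cf_cylinder[of "[]"] by simp
  then show "emeasure gauss_measure (space gauss_measure) = 1"
    by (simp add: space_gauss_measure gauss_word_def)
qed

text \<open>Ensures that the irrational points, on which the cylinder topology lives, carry the full
  Gauss measure.\<close>

lemma gauss_measure_Rats: "cf_X \<inter> \<rat> \<in> null_sets gauss_measure"
proof -
  have c: "countable (cf_X \<inter> \<rat>)" using countable_rat by (rule countable_subset[rotated]) auto
  then have s: "cf_X \<inter> \<rat> \<in> sets gauss_measure"
    unfolding sets_gauss_measure_iff by (auto intro: sets.countable)
  have "emeasure gauss_measure (cf_X \<inter> \<rat>) = 0"
    unfolding emeasure_gauss_measure[OF s]
  proof (subst nn_integral_0_iff_AE)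
    have "AE x in lborel. x \<notin> cf_X \<inter> \<rat>"
      by (rule AE_not_in) (use countable_imp_null_set_lborel[OF c] in auto)
    then show "AE x in lborel. ennreal (1 / ln 2 * (1 / (1 + x))) * indicator (cf_X \<inter> \<rat>) x = 0"
      by eventually_elim auto
  qed (use s in \<open>auto simp: sets_gauss_measure_iff\<close>)
  with s show ?thesis by auto
qed

section \<open>Weighted sums over words\<close>

text \<open>Bounding the digits by \<open>A\<close> keeps all sums finite; the estimates below are
  uniform in \<open>A\<close>.\<close>

definition words :: "nat \<Rightarrow> nat \<Rightarrow> nat list set" where
  "words A n = {u. set u \<subseteq> {1..A} \<and> length u = n}"

lemma finite_words [simp]: "finite (words A n)"
  unfolding words_def by (rule finite_lists_length_eq) simp

lemma words_digits: "u \<in> words A n \<Longrightarrow> \<forall>k\<in>set u. 1 \<le> k"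
  by (auto simp: words_def)

lemma words_0 [simp]: "words A 0 = {[]}"
  by (auto simp: words_def)

lemma sum_words_append:
  "(\<Sum>u\<in>words A (m + n). F u) = (\<Sum>u\<in>words A m. \<Sum>v\<in>words A n. F (u @ v))"
  unfolding sum.cartesian_product
  by (rule sum.reindex_bij_witness[where j = "\<lambda>u. (take m u, drop m u)" and i = "\<lambda>(u, v). u @ v"])
     (auto simp: words_def dest: in_set_takeD in_set_dropD)

lemma sum_words_Suc:
  "(\<Sum>u\<in>words A (Suc n). F u) = (\<Sum>j<A. \<Sum>u\<in>words A n. F (Suc j # u))"
proof -
  have "(\<Sum>u\<in>words A 1. G u) = (\<Sum>j<A. G [Suc j])" for G :: "nat list \<Rightarrow> 'a"
    by (rule sum.reindex_bij_witness[where j = "\<lambda>u. hd u - 1" and i = "\<lambda>j. [Suc j]"])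
       (auto simp: words_def length_Suc_conv)
  then show ?thesis using sum_words_append[of F A 1 n] by simp
qed

lemma cf_transfer_funpow_in_unit:
  assumes "f \<in> {0..1} \<rightarrow> {0..1}"
  shows "(cf_transfer ^^ g) f \<in> {0..1} \<rightarrow> {0..1}"
proof (induction g)
  case (Suc g)
  then show ?case using cf_transfer_in_unit[OF Suc] by auto
qed (use assms in simp)

text \<open>The left side is the iterated operator with all digits above \<open>A\<close> omitted,
  and the omitted terms are nonnegative.\<close>

lemma sum_words_le_cf_transfer:
  assumes f: "f \<in> {0..1} \<rightarrow> {0..1}" and s: "s \<in> {0..1}"
  shows "(\<Sum>u\<in>words A g. word_prob u s * f (word_end u s)) \<le> (cf_transfer ^^ g) f s"
  using s
proof (induction g arbitrary: s)
  case (Suc g)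
  let ?F = "(cf_transfer ^^ g) f"
  have "(\<Sum>u\<in>words A (Suc g). word_prob u s * f (word_end u s)) =
      (\<Sum>j<A. cf_prob (Suc j) s * (\<Sum>u\<in>words A g. word_prob u (1 / (real (Suc j) + s)) * f (word_end u (1 / (real (Suc j) + s)))))"
    by (simp add: sum_words_Suc sum_distrib_left mult.assoc)
  also have "\<dots> \<le> (\<Sum>j<A. cf_prob (Suc j) s * ?F (1 / (real (Suc j) + s)))"
    using Suc.prems cf_prob_pos[of _ s]
    by (intro sum_mono mult_left_mono Suc.IH inverse_digit_in_unit) (auto simp: less_imp_le)
  also have "\<dots> \<le> cf_transfer ?F s"
    using Suc.prems by (intro sum_le_cf_transfer cf_transfer_funpow_in_unit[OF f]) auto
  finally show ?case by simp
qed simp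

lemma sum_word_prob_le_1:
  assumes s: "s \<in> {0..1}"
  shows "(\<Sum>u\<in>words A g. word_prob u s) \<le> 1"
proof -
  have f: "(\<lambda>_. 1) \<in> {0..1::real} \<rightarrow> {0..1::real}" by auto
  have "(\<Sum>u\<in>words A g. word_prob u s) \<le> (cf_transfer ^^ g) (\<lambda>_. 1) s"
    using sum_words_le_cf_transfer[OF f s, of A g] by simp
  also have "\<dots> \<le> 1" using funcset_mem[OF cf_transfer_funpow_in_unit[OF f] s] by simp
  finally show ?thesis .
qed

text \<open>Bounds the sum over all digits of \<open>cf_prob k s\<close> to the power 3/4: the bound
  2/k^2 becomes 2 k^(-3/2), which is summable because 3/4 exceeds 1/2.\<close>

definition powr_mass :: real where
  "powr_mass = (\<Sum>j. 2 * real (Suc j) powr (- 3 / 2))"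

lemma sum_cf_prob_powr_le:
  assumes s: "s \<in> {0..1}"
  shows "(\<Sum>j<A. cf_prob (Suc j) s powr (3 / 4)) \<le> powr_mass"
proof -
  have le: "cf_prob (Suc j) s powr (3 / 4) \<le> 2 * real (Suc j) powr (- 3 / 2)" for j
  proof -
    define k where "k = real (Suc j)"
    have k: "k > 0" by (simp add: k_def)
    have "cf_prob (Suc j) s powr (3 / 4) \<le> (2 / k ^ 2) powr (3 / 4)"
      using cf_prob_le_square[of "Suc j" s] cf_prob_pos[of "Suc j" s] s unfolding k_def
      by (intro powr_mono2) auto
    also have "\<dots> = (2 * k powr (- 2)) powr (3 / 4)"
      using k by (simp add: powr_minus_divide powr_numeral)
    also have "\<dots> = 2 powr (3 / 4) * k powr (- 3 / 2)"
      using k by (simp add: powr_mult powr_powr)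
    also have "2 powr (3 / 4) \<le> (2::real) powr 1" by (rule powr_mono) auto
    finally show ?thesis by (simp add: k_def)
  qed
  have "summable (\<lambda>j. real (Suc j) powr (- 3 / 2))"
    using summable_real_powr_iff[of "- 3 / 2"] by (subst summable_Suc_iff) simp
  then have "(\<Sum>j<A. 2 * real (Suc j) powr (- 3 / 2)) \<le> powr_mass"
    unfolding powr_mass_def by (intro sum_le_suminf summable_mult) auto
  moreover have "(\<Sum>j<A. cf_prob (Suc j) s powr (3 / 4)) \<le> (\<Sum>j<A. 2 * real (Suc j) powr (- 3 / 2))"
    by (intro sum_mono le)
  ultimately show ?thesis by linarith
qed

lemma powr_mass_nonneg: "0 \<le> powr_mass"
  using sum_cf_prob_powr_le[of 0 0] by simp

text \<open>Exponential growth in \<open>n\<close> is harmless: this sum is later multiplied by an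
  exponent loss chosen after the block length.\<close>

lemma sum_word_prob_powr_le:
  assumes s: "s \<in> {0..1}"
  shows "(\<Sum>u\<in>words A n. word_prob u s powr (3 / 4)) \<le> powr_mass ^ n"
  using s
proof (induction n arbitrary: s)
  case (Suc n)
  have "(\<Sum>u\<in>words A (Suc n). word_prob u s powr (3 / 4)) =
      (\<Sum>j<A. cf_prob (Suc j) s powr (3 / 4) * (\<Sum>u\<in>words A n. word_prob u (1 / (real (Suc j) + s)) powr (3 / 4)))"
    using Suc.prems cf_prob_pos[of _ s] word_prob_pos[OF words_digits, of _ A n]
    by (simp add: sum_words_Suc sum_distrib_left powr_mult less_imp_le)
  also have "\<dots> \<le> (\<Sum>j<A. cf_prob (Suc j) s powr (3 / 4) * powr_mass ^ n)"
    using Suc.prems by (intro sum_mono mult_left_mono Suc.IH inverse_digit_in_unit) auto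
  also have "\<dots> \<le> powr_mass * powr_mass ^ n"
    unfolding sum_distrib_right[symmetric]
    using sum_cf_prob_powr_le[OF Suc.prems] powr_mass_nonneg by (intro mult_right_mono) auto
  finally show ?case by simp
qed simp

text \<open>Convexity of the exponential, with 1 - \<eta> written as the combination of the
  exponents 1 and 3/4 with weights 1 - 4\<eta> and 4\<eta>.\<close>

lemma powr_one_minus_le:
  fixes q \<eta> :: real
  assumes "0 < q" "0 \<le> \<eta>" "\<eta> \<le> 1 / 4"
  shows "q powr (1 - \<eta>) \<le> q + 4 * \<eta> * q powr (3 / 4)"
proof -
  have "exp ((1 - 4 * \<eta>) *\<^sub>R ln q + (4 * \<eta>) *\<^sub>R (3 / 4 * ln q)) \<le> (1 - 4 * \<eta>) * exp (ln q) + 4 * \<eta> * exp (3 / 4 * ln q)"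
    using assms by (intro convex_onD[OF exp_convex]) auto
  also have "(1 - 4 * \<eta>) *\<^sub>R ln q + (4 * \<eta>) *\<^sub>R (3 / 4 * ln q) = (1 - \<eta>) * ln q"
    by (simp add: algebra_simps)
  also have "(1 - 4 * \<eta>) * exp (ln q) \<le> 1 * exp (ln q)" using assms by (intro mult_right_mono) auto
  finally show ?thesis using assms by (simp add: powr_def)
qed

text \<open>The growth rate \<open>\<rho>\<close> of one block: \<open>g\<close> free digits followed by a possible occurrence of
  \<open>w\<close>. The last summand is the price of the exponent \<open>1 - \<eta>\<close>.\<close>

definition block_rate :: "nat list \<Rightarrow> nat \<Rightarrow> real \<Rightarrow> real \<Rightarrow> real" where
  "block_rate w g t \<eta> = 1 + t * (gauss_word w + 2 * (7 / 8) ^ g)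
     + (1 + t) * (4 * \<eta> * powr_mass ^ (g + length w))"

text \<open>Three contributions: all blocks together have mass at most 1; those ending in
  \<open>w\<close> are bounded by the transfer operator after \<open>g\<close> free digits; the
  excess of the power 1 - \<eta> over the power 1 is paid with the power 3/4.\<close>

lemma sum_block_le:
  assumes s: "s \<in> {0..1}" and w: "\<forall>k\<in>set w. 1 \<le> k"
    and t: "0 \<le> t" and \<eta>: "0 \<le> \<eta>" "\<eta> \<le> 1 / 4"
  shows "(\<Sum>v\<in>words A (g + length w). (1 + t * of_bool (drop g v = w)) * word_prob v s powr (1 - \<eta>))
    \<le> block_rate w g t \<eta>"
proof -
  let ?W = "words A (g + length w)"
  have pos: "0 < word_prob v s" if "v \<in> ?W" for v
    using word_prob_pos[OF words_digits[OF that], of s] s by auto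
  have "(\<Sum>v\<in>?W. (1 + t * of_bool (drop g v = w)) * word_prob v s powr (1 - \<eta>))
      \<le> (\<Sum>v\<in>?W. word_prob v s + t * (of_bool (drop g v = w) * word_prob v s)
            + (1 + t) * (4 * \<eta> * word_prob v s powr (3 / 4)))"
  proof (rule sum_mono)
    fix v assume v: "v \<in> ?W"
    let ?c = "1 + t * of_bool (drop g v = w)"
    have "?c * word_prob v s powr (1 - \<eta>) \<le> ?c * (word_prob v s + 4 * \<eta> * word_prob v s powr (3 / 4))"
      using t by (intro mult_left_mono powr_one_minus_le pos v \<eta>) auto
    also have "\<dots> = ?c * word_prob v s + ?c * (4 * \<eta> * word_prob v s powr (3 / 4))"
      by (simp add: distrib_left)
    also have "?c * (4 * \<eta> * word_prob v s powr (3 / 4)) \<le> (1 + t) * (4 * \<eta> * word_prob v s powr (3 / 4))"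
      using t \<eta> by (intro mult_right_mono) auto
    finally show "?c * word_prob v s powr (1 - \<eta>) \<le> word_prob v s + t * (of_bool (drop g v = w) * word_prob v s)
            + (1 + t) * (4 * \<eta> * word_prob v s powr (3 / 4))" by (simp add: algebra_simps)
  qed
  also have "\<dots> = (\<Sum>v\<in>?W. word_prob v s) + t * (\<Sum>v\<in>?W. of_bool (drop g v = w) * word_prob v s)
      + (1 + t) * (4 * \<eta> * (\<Sum>v\<in>?W. word_prob v s powr (3 / 4)))"
    by (simp only: sum.distrib sum_distrib_left)
  also have "\<dots> \<le> 1 + t * (gauss_word w + 2 * (7 / 8) ^ g) + (1 + t) * (4 * \<eta> * powr_mass ^ (g + length w))"
  proof (intro add_mono mult_left_mono)
    show "(\<Sum>v\<in>?W. word_prob v s) \<le> 1" by (rule sum_word_prob_le_1[OF s])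
    show "(\<Sum>v\<in>?W. word_prob v s powr (3 / 4)) \<le> powr_mass ^ (g + length w)"
      by (rule sum_word_prob_powr_le[OF s])
    have "(\<Sum>v\<in>?W. of_bool (drop g v = w) * word_prob v s) =
        (\<Sum>u\<in>words A g. \<Sum>v\<in>words A (length w). of_bool (v = w) * word_prob (u @ v) s)"
      unfolding sum_words_append by (intro sum.cong) (auto simp: words_def)
    also have "\<dots> \<le> (\<Sum>u\<in>words A g. word_prob u s * word_prob w (word_end u s))"
    proof (rule sum_mono)
      fix u assume u: "u \<in> words A g"
      have "(\<Sum>v\<in>words A (length w). of_bool (v = w) * word_prob (u @ v) s) =
          (\<Sum>v\<in>words A (length w). if v = w then word_prob (u @ w) s else 0)"
        by (intro sum.cong) auto
      \<comment> \<open>Only an inequality, since \<open>w\<close> may contain digits above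
        \<open>A\<close>, in which case the sum is empty.\<close>
      also have "\<dots> \<le> word_prob (u @ w) s"
        using word_prob_pos[of "u @ w" s] words_digits[OF u] w s by (simp add: sum.delta' ball_Un less_imp_le)
      finally show "(\<Sum>v\<in>words A (length w). of_bool (v = w) * word_prob (u @ v) s)
          \<le> word_prob u s * word_prob w (word_end u s)" by (simp add: word_prob_append)
    qed
    also have "\<dots> \<le> (cf_transfer ^^ g) (word_prob w) s"
      by (rule sum_words_le_cf_transfer[OF word_prob_range[OF w] s])
    also have "\<dots> \<le> gauss_word w + 2 * (7 / 8) ^ g"
      by (rule cf_transfer_word_prob_le[OF w s])
    finally show "(\<Sum>v\<in>?W. of_bool (drop g v = w) * word_prob v s) \<le> gauss_word w + 2 * (7 / 8) ^ g" .
  qed (use t \<eta> in auto)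
  finally show ?thesis by (simp add: block_rate_def)
qed

section \<open>Products of weights over consecutive blocks\<close>

primrec block_weight :: "nat list \<Rightarrow> nat \<Rightarrow> real \<Rightarrow> nat \<Rightarrow> nat list \<Rightarrow> real" where
  "block_weight w g t 0 u = 1"
| "block_weight w g t (Suc m) u =
     (1 + t * of_bool (take (length w) (drop g u) = w)) * block_weight w g t m (drop (g + length w) u)"

lemma block_weight_bounds:
  assumes "0 \<le> t"
  shows "1 \<le> block_weight w g t m u" "block_weight w g t m u \<le> (1 + t) ^ m"
proof -
  have "1 \<le> block_weight w g t m u \<and> block_weight w g t m u \<le> (1 + t) ^ m"
  proof (induction m arbitrary: u)
    case (Suc m)
    let ?c = "1 + t * of_bool (take (length w) (drop g u) = w)"
    have c: "1 \<le> ?c" "?c \<le> 1 + t" using assms by auto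
    have "1 * 1 \<le> ?c * block_weight w g t m (drop (g + length w) u)"
      using c Suc by (intro mult_mono) auto
    moreover have "?c * block_weight w g t m (drop (g + length w) u) \<le> (1 + t) * (1 + t) ^ m"
      using c Suc[of "drop (g + length w) u"] assms by (intro mult_mono) auto
    ultimately show ?case by simp
  qed simp
  then show "1 \<le> block_weight w g t m u" "block_weight w g t m u \<le> (1 + t) ^ m" by auto
qed

text \<open>The bound for one block holds from every starting parameter, in particular from the one
  left behind by the preceding block, so the rates multiply without any independence.\<close>

lemma sum_block_weight_le:
  assumes s: "s \<in> {0..1}" and w: "\<forall>k\<in>set w. 1 \<le> k"
    and t: "0 \<le> t" and \<eta>: "0 \<le> \<eta>" "\<eta> \<le> 1 / 4"
  shows "(\<Sum>u\<in>words A (m * (g + length w)). block_weight w g t m u * word_prob u s powr (1 - \<eta>))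
    \<le> block_rate w g t \<eta> ^ m"
  using s
proof (induction m arbitrary: s)
  case (Suc m)
  let ?b = "g + length w" and ?\<rho> = "block_rate w g t \<eta>"
  have "(0::real) \<le> (\<Sum>v\<in>words A ?b. (1 + t * of_bool (drop g v = w)) * word_prob v s powr (1 - \<eta>))"
    using t by (intro sum_nonneg mult_nonneg_nonneg) auto
  then have \<rho>: "0 \<le> ?\<rho>" using sum_block_le[OF Suc.prems w t \<eta>, of g A] by linarith
  have "(\<Sum>u\<in>words A (Suc m * ?b). block_weight w g t (Suc m) u * word_prob u s powr (1 - \<eta>)) =
      (\<Sum>v\<in>words A ?b. \<Sum>u\<in>words A (m * ?b). block_weight w g t (Suc m) (v @ u) * word_prob (v @ u) s powr (1 - \<eta>))"
    by (simp only: mult_Suc sum_words_append)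
  also have "\<dots> = (\<Sum>v\<in>words A ?b. (1 + t * of_bool (drop g v = w)) * word_prob v s powr (1 - \<eta>)
      * (\<Sum>u\<in>words A (m * ?b). block_weight w g t m u * word_prob u (word_end v s) powr (1 - \<eta>)))"
  proof (intro sum.cong refl, subst sum_distrib_left, intro sum.cong refl)
    fix v u assume v: "v \<in> words A ?b" and u: "u \<in> words A (m * ?b)"
    have l: "length v = ?b" using v by (simp add: words_def)
    have e: "word_end v s \<in> {0..1}" using word_end_in_unit[OF words_digits[OF v] Suc.prems] .
    have "take (length w) (drop g (v @ u)) = drop g v" using l by simp
    moreover have "drop ?b (v @ u) = u" using l by simp
    ultimately have "block_weight w g t (Suc m) (v @ u) = (1 + t * of_bool (drop g v = w)) * block_weight w g t m u"
      by simp
    moreover have "word_prob (v @ u) s powr (1 - \<eta>) = word_prob v s powr (1 - \<eta>) * word_prob u (word_end v s) powr (1 - \<eta>)"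
      using word_prob_pos[OF words_digits[OF v], of s] word_prob_pos[OF words_digits[OF u], of "word_end v s"] e Suc.prems
      by (simp add: word_prob_append powr_mult)
    ultimately show "block_weight w g t (Suc m) (v @ u) * word_prob (v @ u) s powr (1 - \<eta>) =
        (1 + t * of_bool (drop g v = w)) * word_prob v s powr (1 - \<eta>)
        * (block_weight w g t m u * word_prob u (word_end v s) powr (1 - \<eta>))" by simp
  qed
  also have "\<dots> \<le> (\<Sum>v\<in>words A ?b. (1 + t * of_bool (drop g v = w)) * word_prob v s powr (1 - \<eta>) * ?\<rho> ^ m)"
    using t word_end_in_unit[OF words_digits Suc.prems]
    by (intro sum_mono mult_left_mono Suc.IH mult_nonneg_nonneg) auto
  also have "\<dots> \<le> ?\<rho> * ?\<rho> ^ m"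
    unfolding sum_distrib_right[symmetric]
    using \<rho> by (intro mult_right_mono sum_block_le Suc.prems w t \<eta>) auto
  finally show ?case by simp
qed simp

section \<open>Frequencies in a sequence of digits\<close>

declare sum_of_bool_eq [simp del] sum_mult_of_bool_eq [simp del] sum_of_bool_mult_eq [simp del]

text \<open>At \<open>N = 0\<close> the value is 0 by division by zero, which is why complementation
  below requires \<open>1 \<le> N\<close>.\<close>

definition freq :: "(nat \<Rightarrow> bool) \<Rightarrow> nat \<Rightarrow> real" where
  "freq P N = (\<Sum>n<N. of_bool (P n)) / real N"

definition block :: "(nat \<Rightarrow> nat) \<Rightarrow> nat \<Rightarrow> nat \<Rightarrow> nat list" where
  "block d n k = map d [n..<n + k]"

lemma length_block [simp]: "length (block d n k) = k"
  by (simp add: block_def)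

lemma set_block: "set (block d n k) = d ` {n..<n + k}"
  by (simp add: block_def)

lemma take_drop_block: "take k (drop i (block d n (i + k + l))) = block d (n + i) k"
  by (simp add: block_def take_map drop_map add_ac)

lemma drop_block: "drop i (block d n (i + l)) = block d (n + i) l"
  by (simp add: block_def drop_map add_ac)

lemma freq_nonneg: "0 \<le> freq P N"
  by (simp add: freq_def sum_nonneg)

lemma freq_mono: "(\<And>n. P n \<Longrightarrow> Q n) \<Longrightarrow> freq P N \<le> freq Q N"
  unfolding freq_def by (intro divide_right_mono sum_mono) auto

lemma freq_not: "1 \<le> N \<Longrightarrow> freq (\<lambda>n. \<not> P n) N = 1 - freq P N"
proof -
  assume N: "1 \<le> N"
  have "(\<Sum>n<N. of_bool (\<not> P n)) = (\<Sum>n<N. 1 - of_bool (P n) :: real)"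
    by (intro sum.cong) auto
  then show ?thesis using N by (simp add: freq_def sum_subtractf diff_divide_distrib)
qed

text \<open>A shift by \<open>k\<close> loses at most the first \<open>k\<close>
  occurrences.\<close>

lemma freq_shift_ge: "freq P N - real k / real N \<le> freq (\<lambda>n. P (n + k)) N"
proof -
  have "(\<Sum>n<N. of_bool (P n)) \<le> (\<Sum>n<N + k. of_bool (P n) :: real)"
    by (intro sum_mono2) auto
  also have "\<dots> = (\<Sum>n<k. of_bool (P n)) + (\<Sum>n=k..<N + k. of_bool (P n))"
    by (subst sum.atLeastLessThan_concat[symmetric, of 0 k, simplified atLeast0LessThan]) auto
  also have "(\<Sum>n=k..<N + k. of_bool (P n)) = (\<Sum>n<N. of_bool (P (n + k)) :: real)"
    using sum.shift_bounds_nat_ivl[of "\<lambda>n. of_bool (P n) :: real" 0 k N] by (simp add: atLeast0LessThan)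
  also have "(\<Sum>n<k. of_bool (P n)) \<le> (\<Sum>n<k. 1 :: real)" by (intro sum_mono) auto
  finally have "(\<Sum>n<N. of_bool (P n)) - real k \<le> (\<Sum>n<N. of_bool (P (n + k)) :: real)" by simp
  then show ?thesis unfolding freq_def diff_divide_distrib[symmetric] by (intro divide_right_mono) auto
qed

text \<open>The hypothesis is applied at N+k, and (N+k)/N is at most k+1. The factor is crude but
  valid for every positive \<open>N\<close>, as the uniform tightness bound requires.\<close>

lemma freq_shift_le:
  assumes "\<And>N. 1 \<le> N \<Longrightarrow> freq P N \<le> e" "1 \<le> N"
  shows "freq (\<lambda>n. P (n + k)) N \<le> real (k + 1) * e"
proof -
  have "(\<Sum>n<N. of_bool (P (n + k))) = (\<Sum>n=k..<N + k. of_bool (P n) :: real)"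
    using sum.shift_bounds_nat_ivl[of "\<lambda>n. of_bool (P n) :: real" 0 k N] by (simp add: atLeast0LessThan)
  also have "\<dots> \<le> (\<Sum>n<N + k. of_bool (P n))" by (intro sum_mono2) auto
  also have "\<dots> = real (N + k) * freq P (N + k)" using assms(2) by (simp add: freq_def)
  also have "\<dots> \<le> real (N + k) * e" using assms by (intro mult_left_mono) auto
  finally have "freq (\<lambda>n. P (n + k)) N \<le> real (N + k) * e / real N"
    unfolding freq_def by (intro divide_right_mono) auto
  also have "\<dots> = (1 + real k / real N) * e" using assms(2) by (simp add: field_simps)
  also have "\<dots> \<le> (real k + 1) * e"
  proof (rule mult_right_mono)
    have "real k / real N \<le> real k / 1" using assms(2) by (intro divide_left_mono) auto
    then show "1 + real k / real N \<le> real k + 1" by simp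
    show "0 \<le> e" using assms freq_nonneg[of P N] by (meson order_trans)
  qed
  finally show ?thesis by (simp add: add.commute)
qed

lemma freq_Ex_le: "finite I \<Longrightarrow> freq (\<lambda>n. \<exists>i\<in>I. P i n) N \<le> (\<Sum>i\<in>I. freq (P i) N)"
proof -
  assume I: "finite I"
  have "(\<Sum>n<N. of_bool (\<exists>i\<in>I. P i n)) \<le> (\<Sum>n<N. \<Sum>i\<in>I. of_bool (P i n) :: real)"
  proof (rule sum_mono)
    fix n
    show "of_bool (\<exists>i\<in>I. P i n) \<le> (\<Sum>i\<in>I. of_bool (P i n) :: real)"
    proof (cases "\<exists>i\<in>I. P i n")
      case True
      then obtain i where i: "i \<in> I" "P i n" by auto
      have "of_bool (P i n) \<le> (\<Sum>i\<in>I. of_bool (P i n) :: real)"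
        using I i by (intro member_le_sum) auto
      then show ?thesis using i by auto
    qed (simp add: sum_nonneg)
  qed
  also have "\<dots> = (\<Sum>i\<in>I. \<Sum>n<N. of_bool (P i n))" by (rule sum.swap)
  finally show ?thesis unfolding freq_def sum_divide_distrib[symmetric]
    by (intro divide_right_mono) auto
qed

lemma freq_Ex_disjoint:
  assumes "finite I" "\<And>n i j. i \<in> I \<Longrightarrow> j \<in> I \<Longrightarrow> P i n \<Longrightarrow> P j n \<Longrightarrow> i = j"
  shows "freq (\<lambda>n. \<exists>i\<in>I. P i n) N = (\<Sum>i\<in>I. freq (P i) N)"
proof -
  have "of_bool (\<exists>i\<in>I. P i n) = (\<Sum>i\<in>I. of_bool (P i n) :: real)" for n
  proof (cases "\<exists>i\<in>I. P i n")
    case True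
    then obtain i where i: "i \<in> I" "P i n" by auto
    have "(\<Sum>i\<in>I. of_bool (P i n) :: real) = (\<Sum>j\<in>I. if j = i then 1 else 0)"
      using assms(2) i by (intro sum.cong) auto
    then show ?thesis using assms(1) i True by (simp add: sum.delta')
  qed simp
  then have "freq (\<lambda>n. \<exists>i\<in>I. P i n) N = (\<Sum>n<N. \<Sum>i\<in>I. of_bool (P i n)) / real N"
    by (simp add: freq_def)
  also have "(\<Sum>n<N. \<Sum>i\<in>I. of_bool (P i n) :: real) = (\<Sum>i\<in>I. \<Sum>n<N. of_bool (P i n))" by (rule sum.swap)
  finally show ?thesis by (simp add: freq_def sum_divide_distrib)
qed

text \<open>The logarithm turns the product into a count of occurrences at the sparse positions
  \<open>i * (g + length w) + g\<close>, which averages of shifted frequencies can control.\<close>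

lemma ln_block_weight:
  assumes "0 \<le> t"
  shows "ln (block_weight w g t m (block d n (m * (g + length w)))) =
    ln (1 + t) * (\<Sum>i<m. of_bool (block d (n + (i * (g + length w) + g)) (length w) = w))"
proof (induction m arbitrary: n)
  case (Suc m)
  let ?b = "g + length w"
  have l: "Suc m * ?b = g + length w + m * ?b" by simp
  let ?c = "1 + t * of_bool (block d (n + g) (length w) = w)"
  have "block_weight w g t (Suc m) (block d n (Suc m * ?b)) = ?c * block_weight w g t m (block d (n + ?b) (m * ?b))"
    unfolding l using take_drop_block[of "length w" g d n "m * ?b"] drop_block[of ?b d n "m * ?b"]
    by (simp add: add.assoc)
  moreover have "0 < ?c" using assms by (auto simp: add_pos_nonneg)
  moreover have "0 < block_weight w g t m (block d (n + ?b) (m * ?b))"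
    using block_weight_bounds(1)[OF assms, of w g m] by (rule less_le_trans[OF zero_less_one])
  ultimately have "ln (block_weight w g t (Suc m) (block d n (Suc m * ?b))) =
     ln ?c + ln (block_weight w g t m (block d (n + ?b) (m * ?b)))"
    by (simp add: ln_mult)
  also have "ln ?c = ln (1 + t) * of_bool (block d (n + g) (length w) = w)" by simp
  also have "ln (block_weight w g t m (block d (n + ?b) (m * ?b))) =
      ln (1 + t) * (\<Sum>i<m. of_bool (block d (n + (Suc i * ?b + g)) (length w) = w))"
    unfolding Suc by (simp add: add_ac)
  finally show ?case by (simp only: sum.lessThan_Suc_shift distrib_left) simp
qed simp

section \<open>Frequencies of words in a digit sequence with tight digits\<close>

locale capply_digit_in_units =
  fixes d :: "nat \<Rightarrow> nat"
  assumes digit_pos: "1 \<le> d n"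
    and digits_tight: "0 < \<epsilon> \<Longrightarrow> \<exists>A. \<forall>N\<ge>1. freq (\<lambda>n. A < d n) N \<le> \<epsilon>"
begin

abbreviation occ :: "nat list \<Rightarrow> nat \<Rightarrow> bool" where
  "occ w n \<equiv> block d n (length w) = w"

lemma freq_large_digit:
  assumes "0 < \<epsilon>"
  shows "\<exists>A. \<forall>N\<ge>1. freq (\<lambda>n. block d n k \<notin> words A k) N \<le> \<epsilon>"
proof -
  \<comment> \<open>There are \<open>k\<close> positions, each costing a factor of at most
    \<open>k + 1\<close> for the shift; the extra 1 keeps the denominator positive for
    \<open>k = 0\<close>.\<close>
  define e where "e = \<epsilon> / (real k * real (k + 1) + 1)"
  have p: "real k * real (k + 1) + 1 > 0" by (intro add_nonneg_pos) auto
  have "0 < e" using assms p by (simp add: e_def)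
  then obtain A where A: "\<And>N. 1 \<le> N \<Longrightarrow> freq (\<lambda>n. A < d n) N \<le> e" using digits_tight by blast
  have "freq (\<lambda>n. block d n k \<notin> words A k) N \<le> \<epsilon>" if N: "1 \<le> N" for N
  proof -
    have "freq (\<lambda>n. block d n k \<notin> words A k) N \<le> freq (\<lambda>n. \<exists>i\<in>{..<k}. A < d (n + i)) N"
    proof (rule freq_mono)
      fix n assume "block d n k \<notin> words A k"
      then obtain j where "j \<in> {n..<n + k}" "A < d j"
        using digit_pos by (force simp: words_def set_block not_le)
      then show "\<exists>i\<in>{..<k}. A < d (n + i)" by (intro bexI[of _ "j - n"]) auto
    qed
    also have "\<dots> \<le> (\<Sum>i<k. freq (\<lambda>n. A < d (n + i)) N)" by (rule freq_Ex_le) simp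
    also have "\<dots> \<le> (\<Sum>i<k. real (k + 1) * e)"
    proof (rule sum_mono)
      fix i assume i: "i \<in> {..<k}"
      have "freq (\<lambda>n. A < d (n + i)) N \<le> real (i + 1) * e" by (rule freq_shift_le[OF A N])
      also have "\<dots> \<le> real (k + 1) * e" using i \<open>0 < e\<close> by (intro mult_right_mono) auto
      finally show "freq (\<lambda>n. A < d (n + i)) N \<le> real (k + 1) * e" .
    qed
    also have "\<dots> = (real k * real (k + 1)) * e" by simp
    also have "\<dots> \<le> (real k * real (k + 1) + 1) * e" using \<open>0 < e\<close> by (intro mult_right_mono) auto
    also have "\<dots> = \<epsilon>" using p by (simp add: e_def)
    finally show ?thesis .
  qed
  then show ?thesis by blast
qed

end

text \<open>The form in which the growth condition enters. It concerns long words only, since \<psi>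
  is controlled only near 0, and \<delta> turns an upper limit into a bound for all large
  \<open>N\<close>.\<close>

locale cf_normality = capply_digit_in_units +
  assumes freq_word_le: "0 < \<eta> \<Longrightarrow> \<eta> \<le> 1 / 4 \<Longrightarrow> \<exists>C>0. \<exists>k0. \<forall>u. k0 \<le> length u \<longrightarrow> (\<forall>k\<in>set u. 1 \<le> k) \<longrightarrow>
     (\<forall>\<delta>>0. \<forall>\<^sub>F N in sequentially. freq (\<lambda>n. block d n (length u) = u) N \<le> C * word_prob u 0 powr (1 - \<eta>) + \<delta>)"
begin

text \<open>The orbit average of the block weights is at most (C+1)\<rho>^m. Its logarithm dominates
  the average logarithm, and after division by \<open>m\<close> the constant C+1 becomes
  negligible.\<close>

lemma freq_occ_le_block_rate:
  assumes w: "w \<noteq> []" "\<forall>k\<in>set w. 1 \<le> k" and t: "0 < t" and \<eta>: "0 < \<eta>" "\<eta> \<le> 1 / 4" and \<epsilon>: "0 < \<epsilon>"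
  shows "\<forall>\<^sub>F N in sequentially. ln (1 + t) * freq (occ w) N \<le> ln (block_rate w g t \<eta>) + \<epsilon>"
proof -
  define b where "b = g + length w"
  have b: "1 \<le> b" using w by (cases w) (auto simp: b_def)
  define \<rho> where "\<rho> = block_rate w g t \<eta>"
  have \<rho>: "1 \<le> \<rho>"
    using t \<eta> gauss_word_pos[OF w(2)] powr_mass_nonneg by (simp add: \<rho>_def block_rate_def less_imp_le)
  obtain C k0 where C: "0 < C" and hyp: "\<And>u \<delta>. k0 \<le> length u \<Longrightarrow> \<forall>k\<in>set u. 1 \<le> k \<Longrightarrow> 0 < \<delta> \<Longrightarrow>
     \<forall>\<^sub>F N in sequentially. freq (occ u) N \<le> C * word_prob u 0 powr (1 - \<eta>) + \<delta>"
    using freq_word_le[OF \<eta>] by metis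
  \<comment> \<open>With this many blocks ln(C+1)/m is at most \<epsilon>/2. Taking also
    \<open>k0 \<le> m\<close> makes words of \<open>m\<close> nonempty blocks long enough for the
    hypothesis.\<close>
  obtain m0 :: nat where m0: "ln (C + 1) / (\<epsilon> / 2) < m0" using reals_Archimedean2 by blast
  define m where "m = max (max m0 k0) 1"
  have m: "1 \<le> m" "k0 \<le> m" "m0 \<le> m" by (auto simp: m_def)
  have m_ln: "ln (C + 1) \<le> real m * (\<epsilon> / 2)"
  proof -
    have "ln (C + 1) / (\<epsilon> / 2) \<le> m" using m0 m by linarith
    then show ?thesis using \<epsilon> by (simp add: divide_le_eq)
  qed
  define K where "K = m * b"
  have K: "k0 \<le> K" using le_trans[OF m(2) mult_le_mono2[OF b, of m, unfolded mult_1_right]] by (simp only: K_def)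
  define Z where "Z = block_weight w g t m"
  have Z1: "1 \<le> Z u" and Zt: "Z u \<le> (1 + t) ^ m" for u
    using block_weight_bounds[of t w g m u] t by (auto simp: Z_def)
  have t1: "0 < (1 + t) ^ m" using t by simp
  \<comment> \<open>Weights never exceed (1+t)^m, so words with a digit above \<open>A\<close>
    contribute at most 1/2 to the average.\<close>
  define e1 where "e1 = 1 / (2 * (1 + t) ^ m)"
  have "0 < e1" using t1 by (simp add: e1_def)
  then obtain A where A: "\<And>N. 1 \<le> N \<Longrightarrow> freq (\<lambda>n. block d n K \<notin> words A K) N \<le> e1"
    using freq_large_digit[of e1 K] by blast
  define SZ where "SZ = (\<Sum>u\<in>words A K. Z u)"
  have SZ: "0 \<le> SZ" unfolding SZ_def using Z1 by (intro sum_nonneg) (meson order_trans zero_le_one)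
  \<comment> \<open>The errors \<delta> of the finitely many words also add up to at most 1/2. The
    resulting total 1 is absorbed by passing from C to C+1, since \<rho> is at least 1.\<close>
  define \<delta> where "\<delta> = 1 / (2 * (SZ + 1))"
  have \<delta>: "0 < \<delta>" "SZ * \<delta> \<le> 1 / 2" using SZ by (auto simp: \<delta>_def field_simps)
  define R where "R = (C + 1) * \<rho> ^ m"
  have R: "0 < R" using C \<rho> by (auto simp: R_def intro!: mult_pos_pos zero_less_power)
  have lnR: "ln R = ln (C + 1) + real m * ln \<rho>"
    using C \<rho> by (simp add: R_def ln_mult ln_realpow)
  have ev1: "\<forall>\<^sub>F N in sequentially. \<forall>u\<in>words A K. freq (occ u) N \<le> C * word_prob u 0 powr (1 - \<eta>) + \<delta>"
  proof (intro eventually_ball_finite finite_words ballI)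
    fix u assume "u \<in> words A K"
    then show "\<forall>\<^sub>F N in sequentially. freq (occ u) N \<le> C * word_prob u 0 powr (1 - \<eta>) + \<delta>"
      using K by (intro hyp words_digits[of u A K] \<delta>) (auto simp: words_def)
  qed
  have ev2: "\<forall>\<^sub>F N in sequentially. ln (1 + t) * (real K / real N) \<le> \<epsilon> / 2"
  proof -
    have "(\<lambda>N. ln (1 + t) * (real K / real N)) \<longlonglongrightarrow> ln (1 + t) * 0"
      by (intro tendsto_intros lim_const_over_n)
    then have "\<forall>\<^sub>F N in sequentially. ln (1 + t) * (real K / real N) < \<epsilon> / 2"
      by (rule order_tendstoD) (use \<epsilon> in simp)
    then show ?thesis by (rule eventually_mono) simp
  qed
  show ?thesis
    using ev1 ev2 eventually_ge_at_top[of 1]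
  proof eventually_elim
    case (elim N)
    then have N: "0 < real N" by simp
    define avg where "avg = (\<Sum>n<N. Z (block d n K)) / real N"
    have "avg \<le> (\<Sum>n<N. (\<Sum>u\<in>words A K. Z u * of_bool (occ u n)) + (1 + t) ^ m * of_bool (block d n K \<notin> words A K)) / real N"
      unfolding avg_def
    proof (intro divide_right_mono sum_mono)
      fix n
      show "Z (block d n K) \<le> (\<Sum>u\<in>words A K. Z u * of_bool (occ u n)) + (1 + t) ^ m * of_bool (block d n K \<notin> words A K)"
      proof (cases "block d n K \<in> words A K")
        case True
        have "Z (block d n K) * of_bool (occ (block d n K) n) \<le> (\<Sum>u\<in>words A K. Z u * of_bool (occ u n))"
          using True Z1 by (intro member_le_sum) (auto intro: order_trans[OF zero_le_one])
        then show ?thesis using True by simp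
      next
        case False
        moreover have "0 \<le> (\<Sum>u\<in>words A K. Z u * of_bool (occ u n))"
          using Z1 by (intro sum_nonneg mult_nonneg_nonneg) (auto intro: order_trans[OF zero_le_one])
        ultimately show ?thesis using Zt[of "block d n K"] by simp
      qed
    qed simp
    also have "\<dots> = (\<Sum>u\<in>words A K. Z u * freq (occ u) N) + (1 + t) ^ m * freq (\<lambda>n. block d n K \<notin> words A K) N"
    proof -
      have "(\<Sum>n<N. (\<Sum>u\<in>words A K. Z u * of_bool (occ u n)) + (1 + t) ^ m * of_bool (block d n K \<notin> words A K)) =
        (\<Sum>u\<in>words A K. Z u * (\<Sum>n<N. of_bool (occ u n))) + (1 + t) ^ m * (\<Sum>n<N. of_bool (block d n K \<notin> words A K))"
        unfolding sum.distrib sum_distrib_left by (subst sum.swap) (rule refl)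
      then show ?thesis by (simp only: freq_def add_divide_distrib sum_divide_distrib[where A = "words A K"] times_divide_eq_right)
    qed
    also have "\<dots> \<le> (\<Sum>u\<in>words A K. Z u * (C * word_prob u 0 powr (1 - \<eta>) + \<delta>)) + (1 + t) ^ m * e1"
    proof (intro add_mono sum_mono mult_left_mono)
      fix u assume "u \<in> words A K"
      then show "freq (occ u) N \<le> C * word_prob u 0 powr (1 - \<eta>) + \<delta>" using elim(1) by blast
      show "0 \<le> Z u" using Z1 by (rule order_trans[OF zero_le_one])
    qed (use A elim t1 in auto)
    also have "\<dots> = C * (\<Sum>u\<in>words A K. Z u * word_prob u 0 powr (1 - \<eta>)) + SZ * \<delta> + (1 + t) ^ m * e1"
      by (simp add: SZ_def distrib_left sum.distrib sum_distrib_left sum_distrib_right mult_ac)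
    also have "\<dots> \<le> C * \<rho> ^ m + 1 / 2 + 1 / 2"
    proof (intro add_mono mult_left_mono)
      show "(\<Sum>u\<in>words A K. Z u * word_prob u 0 powr (1 - \<eta>)) \<le> \<rho> ^ m"
        unfolding K_def b_def Z_def \<rho>_def
        by (rule sum_block_weight_le) (use w t \<eta> in auto)
      show "(1 + t) ^ m * e1 \<le> 1 / 2" using t1 by (simp add: e1_def)
    qed (use C \<delta> in auto)
    also have "\<dots> \<le> R" using one_le_power[OF \<rho>, of m] by (simp add: R_def distrib_right)
    finally have avg: "avg \<le> R" .
    have "(\<Sum>i<m. freq (\<lambda>n. occ w (n + (i * b + g))) N) * ln (1 + t) = (\<Sum>n<N. ln (Z (block d n K))) / real N"
    proof -
      have "ln (Z (block d n K)) = ln (1 + t) * (\<Sum>i<m. of_bool (occ w (n + (i * b + g))))" for n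
        unfolding Z_def K_def b_def using t by (intro ln_block_weight) simp
      then have "(\<Sum>n<N. ln (Z (block d n K))) = ln (1 + t) * (\<Sum>n<N. \<Sum>i<m. of_bool (occ w (n + (i * b + g))))"
        by (simp only: sum_distrib_left)
      also have "(\<Sum>n<N. \<Sum>i<m. of_bool (occ w (n + (i * b + g))) :: real) = (\<Sum>i<m. \<Sum>n<N. of_bool (occ w (n + (i * b + g))))"
        by (rule sum.swap)
      finally show ?thesis by (simp add: freq_def sum_divide_distrib[symmetric] mult.commute)
    qed
    \<comment> \<open>Jensen's inequality for the logarithm, through its tangent line at
      \<open>R\<close>.\<close>
    also have "\<dots> \<le> (\<Sum>n<N. Z (block d n K) / R - 1 + ln R) / real N"
    proof (intro divide_right_mono sum_mono)
      fix n
      have z: "0 < Z (block d n K)" using Z1 by (rule less_le_trans[OF zero_less_one])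
      have "ln (Z (block d n K) / R) \<le> Z (block d n K) / R - 1" using z R by (intro ln_le_minus_one) auto
      then show "ln (Z (block d n K)) \<le> Z (block d n K) / R - 1 + ln R" using z R by (simp add: ln_div)
    qed simp
    also have "\<dots> = avg / R - 1 + ln R"
      using N by (simp add: avg_def sum.distrib sum_subtractf sum_divide_distrib[symmetric] field_simps)
    also have "\<dots> \<le> ln R" using avg R by simp
    finally have upper: "(\<Sum>i<m. freq (\<lambda>n. occ w (n + (i * b + g))) N) * ln (1 + t) \<le> ln R" .
    have lnt: "0 < ln (1 + t)" using t by simp
    \<comment> \<open>All \<open>m\<close> positions lie within the word of length \<open>K\<close>,
      so each shifted frequency is within K/N of the unshifted one from below.\<close>
    have "(\<Sum>i<m. freq (occ w) N - real K / real N) \<le> (\<Sum>i<m. freq (\<lambda>n. occ w (n + (i * b + g))) N)"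
    proof (rule sum_mono)
      fix i assume i: "i \<in> {..<m}"
      have "i * b + g \<le> Suc i * b" by (simp add: b_def)
      also have "\<dots> \<le> K" unfolding K_def using i by (intro mult_le_mono1) auto
      finally have "real (i * b + g) / real N \<le> real K / real N"
        by (intro divide_right_mono) (simp_all only: of_nat_le_iff of_nat_0_le_iff)
      then show "freq (occ w) N - real K / real N \<le> freq (\<lambda>n. occ w (n + (i * b + g))) N"
        using freq_shift_ge[of "occ w" N "i * b + g"] by linarith
    qed
    then have "real m * (freq (occ w) N - real K / real N) * ln (1 + t) \<le> ln (C + 1) + real m * ln \<rho>"
      using upper mult_right_mono[OF _ less_imp_le[OF lnt]] unfolding lnR by fastforce
    also have "\<dots> \<le> real m * (ln \<rho> + \<epsilon> / 2)" using m_ln by (simp add: distrib_left)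
    finally have "(freq (occ w) N - real K / real N) * ln (1 + t) \<le> ln \<rho> + \<epsilon> / 2"
      using m by (simp add: mult.assoc)
    moreover have "ln (1 + t) * freq (occ w) N =
        (freq (occ w) N - real K / real N) * ln (1 + t) + ln (1 + t) * (real K / real N)"
      by (simp add: algebra_simps)
    ultimately show "ln (1 + t) * freq (occ w) N \<le> ln (block_rate w g t \<eta>) + \<epsilon>"
      using elim(2) unfolding \<rho>_def[symmetric] by linarith
  qed
qed

text \<open>For small \<open>t\<close> both ln \<rho> and ln(1+t) are linear in \<open>t\<close> to
  first order, and their quotient tends to \<open>gauss_word w\<close> once the gap and exponent
  errors are small compared with \<open>t\<close>.\<close>

lemma freq_occ_le:
  assumes w: "w \<noteq> []" "\<forall>k\<in>set w. 1 \<le> k" and \<epsilon>: "0 < \<epsilon>" "\<epsilon> \<le> 1" and p1: "gauss_word w \<le> 1"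
  shows "\<forall>\<^sub>F N in sequentially. freq (occ w) N \<le> gauss_word w + \<epsilon>"
proof -
  let ?p = "gauss_word w"
  define t where "t = \<epsilon> / 4"
  have t: "0 < t" "t \<le> 1" using \<epsilon> by (auto simp: t_def)
  have "(\<lambda>g. (7 / 8) ^ g) \<longlonglongrightarrow> (0::real)" by (intro LIMSEQ_realpow_zero) auto
  then have "\<forall>\<^sub>F g in sequentially. (7 / 8) ^ g < \<epsilon> / 16" by (rule order_tendstoD) (use \<epsilon> in simp)
  then obtain g where g: "(7 / 8) ^ g < \<epsilon> / 16" by (auto simp: eventually_sequentially)
  define H where "H = powr_mass ^ (g + length w)"
  have H: "0 \<le> H" unfolding H_def using powr_mass_nonneg by simp
  \<comment> \<open>Chosen last: the cost of the exponent grows with the gap \<open>g\<close> and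
    must stay small relative to \<open>t\<close>.\<close>
  define \<eta> where "\<eta> = min (1 / 4) (\<epsilon> * t / (64 * (H + 1)))"
  have \<eta>: "0 < \<eta>" "\<eta> \<le> 1 / 4" "\<eta> \<le> \<epsilon> * t / (64 * (H + 1))"
  proof -
    show "0 < \<eta>" unfolding \<eta>_def using \<epsilon> t H by (simp add: add_nonneg_pos)
  qed (unfold \<eta>_def, rule min.cobounded1, rule min.cobounded2)
  have "\<eta> * (64 * (H + 1)) \<le> \<epsilon> * t" using \<eta>(3) H by (simp add: le_divide_eq)
  then have \<eta>H: "64 * (\<eta> * H) \<le> \<epsilon> * t" using \<eta>(1) by (simp add: algebra_simps)
  define \<rho> where "\<rho> = block_rate w g t \<eta>"
  have \<rho>: "\<rho> - 1 = t * (?p + 2 * (7 / 8) ^ g) + (1 + t) * (4 * (\<eta> * H))"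
    by (simp add: \<rho>_def block_rate_def H_def)
  have \<rho>1: "1 \<le> \<rho>"
  proof -
    have "0 \<le> \<rho> - 1" unfolding \<rho> using t \<eta> H gauss_word_pos[OF w(2)] by (intro add_nonneg_nonneg mult_nonneg_nonneg) auto
    then show ?thesis by simp
  qed
  have "0 < \<epsilon> * t / 8" using \<epsilon> t by simp
  from freq_occ_le_block_rate[OF w t(1) \<eta>(1,2) this, of g]
  show ?thesis
  proof eventually_elim
    case (elim N)
    have "t / (1 + t) \<le> ln (1 + t)"
    proof -
      have "ln (1 / (1 + t)) \<le> 1 / (1 + t) - 1" using t by (intro ln_le_minus_one) auto
      then show ?thesis using t by (simp add: ln_div field_simps)
    qed
    then have "t / (1 + t) * freq (occ w) N \<le> ln (1 + t) * freq (occ w) N"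
      by (intro mult_right_mono freq_nonneg)
    also have "\<dots> \<le> ln \<rho> + \<epsilon> * t / 8" using elim by (simp add: \<rho>_def)
    also have "ln \<rho> \<le> \<rho> - 1" using \<rho>1 by (intro ln_le_minus_one) auto
    also have "\<rho> - 1 \<le> t * (?p + \<epsilon> / 8) + 2 * (\<epsilon> * t / 16)"
      unfolding \<rho>
    proof (intro add_mono mult_mono)
      show "2 * (7 / 8) ^ g \<le> \<epsilon> / 8" using g by simp
      show "4 * (\<eta> * H) \<le> \<epsilon> * t / 16" using \<eta>H by simp
    qed (use t \<eta> H gauss_word_pos[OF w(2)] in \<open>auto simp: less_imp_le\<close>)
    finally have "t / (1 + t) * freq (occ w) N \<le> t * (?p + 3 * \<epsilon> / 8)"
      by (simp add: algebra_simps)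
    then have "(1 + t) / t * (t / (1 + t) * freq (occ w) N) \<le> (1 + t) / t * (t * (?p + 3 * \<epsilon> / 8))"
      using t by (intro mult_left_mono) auto
    then have "freq (occ w) N \<le> (1 + t) * (?p + 3 * \<epsilon> / 8)"
      using t by simp
    \<comment> \<open>With t = \<epsilon>/4 and \<open>?p\<close> at most 1 the error is at most
      3\<epsilon>/8 + \<epsilon>/4 + 3\<epsilon>/8 = \<epsilon>.\<close>
    also have "\<dots> = ?p + 3 * \<epsilon> / 8 + t * ?p + t * (3 * \<epsilon> / 8)" by (simp add: algebra_simps)
    also have "t * ?p \<le> t" using t p1 by (simp add: mult_left_le)
    also have "t * (3 * \<epsilon> / 8) \<le> 1 * (3 * \<epsilon> / 8)" using t \<epsilon> by (intro mult_right_mono) auto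
    finally show ?case using \<epsilon> by (simp add: t_def)
  qed
qed

end

section \<open>Orbits and the cylinder topology\<close>

lemma cf_cylinder_subset_cf_X: "cf_cylinder w \<subseteq> cf_X"
  by (auto simp: cf_cylinder_def)

text \<open>A point determines its digits; hence two cylinders are either nested or
  disjoint.\<close>

lemma cf_cylinder_prefix:
  assumes "y \<in> cf_cylinder u" "y \<in> cf_cylinder v" "length u \<le> length v"
  shows "u = take (length u) v"
proof (rule nth_equalityI)
  fix i assume i: "i < length u"
  have "int (u ! i) = \<lfloor>1 / (cf_T ^^ i) y\<rfloor>" "int (v ! i) = \<lfloor>1 / (cf_T ^^ i) y\<rfloor>"
    using assms i by (auto simp: cf_cylinder_def)
  then show "u ! i = take (length u) v ! i" using i by simp
qed (use assms in simp)

lemma cf_cylinder_take: "cf_cylinder v \<subseteq> cf_cylinder (take m v)"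
  by (auto simp: cf_cylinder_def)

lemma cf_cylinder_nested:
  assumes "y \<in> cf_cylinder u" "y \<in> cf_cylinder v" "length u \<le> length v"
  shows "cf_cylinder v \<subseteq> cf_cylinder u"
  by (subst cf_cylinder_prefix[OF assms]) (rule cf_cylinder_take)

lemma measure_Union_cf_cylinders:
  assumes F: "finite F" "\<And>w. w \<in> F \<Longrightarrow> \<forall>k\<in>set w. 1 \<le> k" "disjoint_family_on cf_cylinder F"
  shows "measure gauss_measure (\<Union>w\<in>F. cf_cylinder w) = (\<Sum>w\<in>F. gauss_word w)"
proof -
  interpret prob_space gauss_measure by (rule prob_space_gauss_measure)
  have "measure gauss_measure (\<Union>w\<in>F. cf_cylinder w) = (\<Sum>w\<in>F. measure gauss_measure (cf_cylinder w))"
    using F cf_cylinder_sets sets_cf_borel_subset by (intro finite_measure_finite_Union) auto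
  also have "\<dots> = (\<Sum>w\<in>F. gauss_word w)"
    using F(2) by (intro sum.cong measure_cf_cylinder) auto
  finally show ?thesis .
qed

lemma sum_gauss_word_le_1:
  assumes "finite F" "\<And>w. w \<in> F \<Longrightarrow> (\<forall>k\<in>set w. 1 \<le> k) \<and> length w = r"
  shows "(\<Sum>w\<in>F. gauss_word w) \<le> 1"
proof -
  interpret prob_space gauss_measure by (rule prob_space_gauss_measure)
  have "disjoint_family_on cf_cylinder F"
    unfolding disjoint_family_on_def
  proof (intro ballI impI)
    fix u v assume uv: "u \<in> F" "v \<in> F" "u \<noteq> v"
    then have "length u = length v" using assms(2) by simp
    then have "y \<notin> cf_cylinder v" if "y \<in> cf_cylinder u" for y
      using cf_cylinder_prefix[OF that, of v] uv by auto
    then show "cf_cylinder u \<inter> cf_cylinder v = {}" by blast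
  qed
  then have "measure gauss_measure (\<Union>w\<in>F. cf_cylinder w) = (\<Sum>w\<in>F. gauss_word w)"
    using assms by (intro measure_Union_cf_cylinders) auto
  then show ?thesis using prob_le_1 by metis
qed

lemma gauss_word_le_1: "\<forall>k\<in>set w. 1 \<le> k \<Longrightarrow> gauss_word w \<le> 1"
  using sum_gauss_word_le_1[of "{w}" "length w"] by simp

section \<open>Convergence of the frequency of every word\<close>

context cf_normality
begin

lemma freq_occ_upper:
  assumes w: "w \<noteq> []" "\<forall>k\<in>set w. 1 \<le> k" and \<epsilon>: "0 < \<epsilon>"
  shows "\<forall>\<^sub>F N in sequentially. freq (occ w) N \<le> gauss_word w + \<epsilon>"
proof -
  have "\<forall>\<^sub>F N in sequentially. freq (occ w) N \<le> gauss_word w + min \<epsilon> 1"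
    using \<epsilon> by (intro freq_occ_le w gauss_word_le_1) auto
  then show ?thesis by eventually_elim simp
qed

text \<open>No mass escapes: up to \<epsilon>/2 every position starts a word of the same length with
  digits at most \<open>A\<close>. The upper bounds for the other such words leave at least
  \<open>gauss_word w\<close> minus an error for \<open>w\<close>.\<close>

lemma freq_occ_lower:
  assumes w: "w \<noteq> []" "\<forall>k\<in>set w. 1 \<le> k" and \<epsilon>: "0 < \<epsilon>"
  shows "\<forall>\<^sub>F N in sequentially. gauss_word w - \<epsilon> \<le> freq (occ w) N"
proof -
  define r where "r = length w"
  have r: "r \<ge> 1" using w by (cases w) (auto simp: r_def)
  have "0 < \<epsilon> / 2" using \<epsilon> by simp
  then obtain A where A: "\<And>N. 1 \<le> N \<Longrightarrow> freq (\<lambda>n. block d n r \<notin> words A r) N \<le> \<epsilon> / 2"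
    using freq_large_digit[of "\<epsilon> / 2" r] by blast
  \<comment> \<open>The word \<open>w\<close> is put back by \<open>insert\<close> because it need
    not have all digits at most \<open>A\<close>.\<close>
  define F where "F = words A r - {w}"
  have F: "finite F" "w \<notin> F" by (auto simp: F_def)
  have F': "u \<noteq> [] \<and> (\<forall>k\<in>set u. 1 \<le> k) \<and> length u = r" if "u \<in> F" for u
    using r that by (auto simp: F_def words_def)
  define \<delta> where "\<delta> = \<epsilon> / (2 * (real (card F) + 1))"
  have \<delta>: "0 < \<delta>" "real (card F) * \<delta> \<le> \<epsilon> / 2" using \<epsilon> by (auto simp: \<delta>_def field_simps)
  have "\<forall>\<^sub>F N in sequentially. \<forall>u\<in>F. freq (occ u) N \<le> gauss_word u + \<delta>"
    using F F' \<delta> by (intro eventually_ball_finite ballI freq_occ_upper) auto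
  then show ?thesis using eventually_ge_at_top[of 1]
  proof eventually_elim
    case (elim N)
    have "1 - \<epsilon> / 2 \<le> freq (\<lambda>n. block d n r \<in> words A r) N"
      using A[of N] freq_not[of N "\<lambda>n. block d n r \<in> words A r"] elim by simp
    also have "\<dots> \<le> freq (\<lambda>n. \<exists>u\<in>insert w F. occ u n) N"
    proof (rule freq_mono)
      fix n assume "block d n r \<in> words A r"
      then have "block d n r \<in> insert w F" by (simp add: F_def)
      then show "\<exists>u\<in>insert w F. occ u n" by (rule bexI[rotated]) simp
    qed
    also have "\<dots> \<le> (\<Sum>u\<in>insert w F. freq (occ u) N)" using F by (intro freq_Ex_le) auto
    also have "\<dots> = freq (occ w) N + (\<Sum>u\<in>F. freq (occ u) N)" using F by simp
    also have "(\<Sum>u\<in>F. freq (occ u) N) \<le> (\<Sum>u\<in>F. gauss_word u + \<delta>)"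
      using elim by (intro sum_mono) auto
    also have "\<dots> = (\<Sum>u\<in>F. gauss_word u) + real (card F) * \<delta>" by (simp add: sum.distrib)
    finally have "1 - \<epsilon> / 2 \<le> freq (occ w) N + (\<Sum>u\<in>F. gauss_word u) + real (card F) * \<delta>"
      by simp
    moreover have "(\<Sum>u\<in>insert w F. gauss_word u) \<le> 1"
      by (rule sum_gauss_word_le_1[where r = r]) (use F F' w in \<open>auto simp: r_def\<close>)
    ultimately show ?case using \<delta> F by simp
  qed
qed

lemma freq_occ_tendsto:
  assumes w: "w \<noteq> []" "\<forall>k\<in>set w. 1 \<le> k"
  shows "freq (occ w) \<longlonglongrightarrow> gauss_word w"
proof (rule tendstoI)
  fix \<epsilon> :: real assume "0 < \<epsilon>"
  then have "0 < \<epsilon> / 2" by simp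
  from freq_occ_lower[OF w this] freq_occ_upper[OF w this]
  show "\<forall>\<^sub>F N in sequentially. dist (freq (occ w) N) (gauss_word w) < \<epsilon>"
    by eventually_elim (use \<open>0 < \<epsilon>\<close> in \<open>auto simp: dist_real_def abs_less_iff\<close>)
qed

end

text \<open>Counted from 0, so entry \<open>n\<close> is the digit number n+1. A vanishing iterate
  gives the value 0, which is never a digit.\<close>

definition capply_digit_in_unit :: "real \<Rightarrow> nat \<Rightarrow> nat" where
  "capply_digit_in_unit y n = nat \<lfloor>1 / (cf_T ^^ n) y\<rfloor>"

lemma cf_T_irrational:
  assumes "y \<in> cf_X - \<rat>"
  shows "cf_T y \<in> cf_X - \<rat>"
proof -
  have "y \<noteq> 0" using assms by auto
  then have "y = 1 / (cf_T y + of_int \<lfloor>1 / y\<rfloor>)" by (simp add: cf_T_def)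
  then have "cf_T y \<in> \<rat> \<Longrightarrow> y \<in> \<rat>" by (metis Rats_1 Rats_add Rats_divide Rats_of_int)
  then show ?thesis using assms cf_T_mem by auto
qed

lemma funpow_cf_T_irrational: "y \<in> cf_X - \<rat> \<Longrightarrow> (cf_T ^^ n) y \<in> cf_X - \<rat>"
proof (induction n)
  case (Suc n)
  then show ?case using cf_T_irrational[of "(cf_T ^^ n) y"] by simp
qed simp

lemma floor_inverse_pos:
  assumes "y \<in> cf_X" "y \<noteq> 0"
  shows "1 \<le> \<lfloor>1 / y\<rfloor>"
proof -
  have "1 \<le> 1 / y" using assms by (auto simp: cf_X_def)
  then show ?thesis by linarith
qed

lemma capply_digit_in_unit_pos:
  assumes "y \<in> cf_X - \<rat>"
  shows "1 \<le> capply_digit_in_unit y n"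
proof -
  have "(cf_T ^^ n) y \<in> cf_X" "(cf_T ^^ n) y \<noteq> 0"
    using funpow_cf_T_irrational[OF assms, of n] by auto
  from floor_inverse_pos[OF this] show ?thesis unfolding capply_digit_in_unit_def by linarith
qed

text \<open>Translates visits of the orbit to cylinders into occurrences of words; irrationality
  guarantees that all digits exist.\<close>

lemma mem_cf_cylinder_iff:
  assumes "y \<in> cf_X - \<rat>"
  shows "(cf_T ^^ n) y \<in> cf_cylinder w \<longleftrightarrow> block (capply_digit_in_unit y) n (length w) = w"
proof -
  have nz: "(cf_T ^^ i) y \<in> cf_X" "(cf_T ^^ i) y \<noteq> 0" for i
    using funpow_cf_T_irrational[OF assms, of i] by auto
  have D: "\<lfloor>1 / (cf_T ^^ i) ((cf_T ^^ n) y)\<rfloor> = int (w ! i) \<longleftrightarrow> capply_digit_in_unit y (n + i) = w ! i" for i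
  proof -
    have "(cf_T ^^ i) ((cf_T ^^ n) y) = (cf_T ^^ (n + i)) y" by (simp only: add.commute[of n] funpow_add o_apply)
    moreover have "1 \<le> \<lfloor>1 / (cf_T ^^ (n + i)) y\<rfloor>" using floor_inverse_pos nz by blast
    moreover have "f = int m \<longleftrightarrow> nat f = m" if "1 \<le> f" for f m using that by auto
    ultimately show ?thesis by (simp only: capply_digit_in_unit_def)
  qed
  have "(cf_T ^^ i) ((cf_T ^^ n) y) \<noteq> 0" for i
    using nz(2)[of "i + n"] by (simp only: funpow_add o_apply not_False_eq_True)
  then have "(cf_T ^^ n) y \<in> cf_cylinder w \<longleftrightarrow> (\<forall>i<length w. capply_digit_in_unit y (n + i) = w ! i)"
    unfolding cf_cylinder_def mem_Collect_eq using nz(1)[of n] D by blast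
  also have "\<dots> \<longleftrightarrow> block (capply_digit_in_unit y) n (length w) = w"
    unfolding list_eq_iff_nth_eq length_block by (simp add: block_def)
  finally show ?thesis .
qed

lemma mem_cf_cylinder_digits:
  assumes "y \<in> cf_X - \<rat>"
  shows "y \<in> cf_cylinder (block (capply_digit_in_unit y) 0 n)"
  using mem_cf_cylinder_iff[OF assms, of 0 "block (capply_digit_in_unit y) 0 n"] by simp

lemma block_digits_pos:
  assumes "y \<in> cf_X - \<rat>"
  shows "\<forall>k\<in>set (block (capply_digit_in_unit y) n l). 1 \<le> k"
  using capply_digit_in_unit_pos[OF assms] by (auto simp: set_block)

text \<open>The end points are \<open>word_prob w 0\<close> apart, and every digit at least halves
  this length.\<close>

lemma cf_cylinder_diam:
  assumes w: "\<forall>k\<in>set w. 1 \<le> k" and yz: "y \<in> cf_cylinder w" "z \<in> cf_cylinder w"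
  shows "\<bar>y - z\<bar> \<le> (1 / 2) ^ length w"
proof -
  let ?a = "cf_branch w 0" and ?b = "cf_branch w 1"
  have bounds: "min ?a ?b \<le> y \<and> y \<le> max ?a ?b" if "y \<in> cf_cylinder w" for y
    using cf_cylinder_iff_between[OF w, of y] that by (cases "y = ?a \<or> y = ?b") auto
  have "\<bar>y - z\<bar> \<le> \<bar>?b - ?a\<bar>"
    using bounds[OF yz(1)] bounds[OF yz(2)] by (auto simp: min_def max_def split: if_splits)
  also have "\<dots> = \<bar>word_prob w 0\<bar>" by (simp add: word_prob_zero[OF w] abs_mult power_abs)
  also have "\<dots> \<le> (1 / 2) ^ length w"
    using word_prob_le_power_half[OF w, of 0] word_prob_pos[OF w, of 0] by simp
  finally show ?thesis .
qed

lemma capply_digit_in_unit_inject: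
  assumes y: "y \<in> cf_X - \<rat>" and z: "z \<in> cf_X - \<rat>" and eq: "capply_digit_in_unit y = capply_digit_in_unit z"
  shows "y = z"
proof -
  have "\<bar>y - z\<bar> \<le> (1 / 2) ^ n" for n
    using cf_cylinder_diam[OF block_digits_pos[OF y] mem_cf_cylinder_digits[OF y], of z n]
      mem_cf_cylinder_digits[OF z, of n] eq by simp
  moreover have "(\<lambda>n. (1 / 2) ^ n) \<longlonglongrightarrow> (0::real)" by (intro LIMSEQ_realpow_zero) auto
  ultimately have "\<bar>y - z\<bar> \<le> 0" by (intro LIMSEQ_le_const) auto
  then show ?thesis by simp
qed

text \<open>On fractions the map is Euclid's algorithm: p/q goes to (q mod p)/p.\<close>

lemma cf_T_terminates:
  "p < q \<Longrightarrow> \<exists>n. (cf_T ^^ n) (real p / real q) = 0"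
proof (induction p arbitrary: q rule: less_induct)
  case (less p)
  show ?case
  proof (cases "p = 0")
    case True
    then have "(cf_T ^^ 0) (real p / real q) = 0" by simp
    then show ?thesis by blast
  next
    case False
    have "cf_T (real p / real q) = real q / real p - real (q div p)"
      using False less.prems by (simp add: cf_T_def floor_divide_of_nat_eq)
    also have "\<dots> = real (q mod p) / real p"
    proof -
      have "real q = real (q div p) * real p + real (q mod p)"
        by (metis div_mult_mod_eq of_nat_add of_nat_mult)
      then show ?thesis using False by (simp add: field_simps)
    qed
    finally have T: "cf_T (real p / real q) = real (q mod p) / real p" .
    obtain n where "(cf_T ^^ n) (real (q mod p) / real p) = 0"
      using less.IH[of "q mod p" p] False by auto
    then have "(cf_T ^^ Suc n) (real p / real q) = 0" by (simp only: funpow_Suc_right o_apply T)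
    then show ?thesis by blast
  qed
qed

lemma rational_not_in_cylinders:
  assumes "y \<in> cf_X \<inter> \<rat>"
  shows "\<exists>n. \<forall>w. n < length w \<longrightarrow> y \<notin> cf_cylinder w"
proof -
  have "y \<in> \<rat>" "0 \<le> y" "y < 1" using assms by (auto simp: cf_X_def)
  then obtain p q :: nat where "q \<noteq> 0" "\<bar>y\<bar> = real p / real q" by (rule_tac Rats_abs_nat_div_natE)
  then have y: "y = real p / real q" "real p / real q < 1" using \<open>0 \<le> y\<close> \<open>y < 1\<close> by auto
  then have "p < q" using \<open>q \<noteq> 0\<close> by simp
  then obtain n where "(cf_T ^^ n) y = 0" using cf_T_terminates y by auto
  then show ?thesis by (intro exI[of _ n]) (auto simp: cf_cylinder_def)
qed

section \<open>The cylinder topology and its Borel sets\<close>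

definition pos_words :: "nat list set" where
  "pos_words = {w. w \<noteq> [] \<and> (\<forall>k\<in>set w. 1 \<le> k)}"

text \<open>Irrational points are those with infinitely many digits. This exhibits them as a
  countable intersection of countable unions of cylinders, hence as a Borel set.\<close>

lemma irrationals_eq: "cf_X - \<rat> = (\<Inter>n. \<Union>w\<in>{w\<in>pos_words. n < length w}. cf_cylinder w)"
proof (intro equalityI subsetI)
  fix y assume y: "y \<in> cf_X - \<rat>"
  show "y \<in> (\<Inter>n. \<Union>w\<in>{w\<in>pos_words. n < length w}. cf_cylinder w)"
  proof
    fix n
    have "block (capply_digit_in_unit y) 0 (Suc n) \<in> {w\<in>pos_words. n < length w}"
      using block_digits_pos[OF y, of 0 "Suc n"] by (auto simp: block_def pos_words_def)
    then show "y \<in> (\<Union>w\<in>{w\<in>pos_words. n < length w}. cf_cylinder w)"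
      using mem_cf_cylinder_digits[OF y, of "Suc n"] by blast
  qed
next
  fix y assume y: "y \<in> (\<Inter>n. \<Union>w\<in>{w\<in>pos_words. n < length w}. cf_cylinder w)"
  have ex: "\<exists>w. n < length w \<and> y \<in> cf_cylinder w" for n
    using INT_D[OF y UNIV_I, of n] by blast
  then have "y \<in> cf_X" using cf_cylinder_subset_cf_X by blast
  moreover have "y \<notin> \<rat>"
  proof
    assume "y \<in> \<rat>"
    with \<open>y \<in> cf_X\<close> obtain n where "\<forall>w. n < length w \<longrightarrow> y \<notin> cf_cylinder w"
      using rational_not_in_cylinders[of y] by blast
    with ex[of n] show False by blast
  qed
  ultimately show "y \<in> cf_X - \<rat>" by blast
qed

lemma irrationals_sets: "cf_X - \<rat> \<in> sets cf_borel"
  unfolding irrationals_eq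
  by (intro sets.countable_INT' sets.countable_UN' image_subsetI cf_cylinder_sets) (auto simp: pos_words_def)

text \<open>Intersecting cylinders are nested, so the generating family is already a base for
  nonempty open sets.\<close>

lemma openin_generated_base:
  assumes "openin (topology_generated_by cf_cylinders) U" "y \<in> U"
  shows "\<exists>w\<in>pos_words. y \<in> cf_cylinder w \<and> cf_cylinder w \<subseteq> U"
proof -
  have "generate_topology_on cf_cylinders U" using assms(1) by (simp add: openin_topology_generated_by_iff)
  then show ?thesis using assms(2)
  proof (induction rule: generate_topology_on.induct)
    case (Int a b)
    then obtain u v where u: "u \<in> pos_words" "y \<in> cf_cylinder u" "cf_cylinder u \<subseteq> a"
      and v: "v \<in> pos_words" "y \<in> cf_cylinder v" "cf_cylinder v \<subseteq> b" by blast
    have "cf_cylinder u \<subseteq> cf_cylinder v \<or> cf_cylinder v \<subseteq> cf_cylinder u"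
      using cf_cylinder_nested[OF u(2) v(2)] cf_cylinder_nested[OF v(2) u(2)] nat_le_linear by blast
    then show ?case using u v by (meson Int_greatest order_trans)
  next
    case (UN K)
    then obtain k where k: "k \<in> K" "y \<in> k" by blast
    then obtain w where "w \<in> pos_words" "y \<in> cf_cylinder w" "cf_cylinder w \<subseteq> k"
      using UN.IH[OF k] by blast
    moreover have "k \<subseteq> \<Union>K" using k(1) by (rule Union_upper)
    ultimately show ?case by (meson order_trans)
  next
    case (Basis s)
    then obtain w where "s = cf_cylinder w" "w \<in> pos_words" by (auto simp: cf_cylinders_def pos_words_def)
    with Basis.prems show ?case by blast
  qed simp
qed

lemma openin_cf_cylinder: "w \<in> pos_words \<Longrightarrow> openin (topology_generated_by cf_cylinders) (cf_cylinder w)"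
  by (rule topology_generated_by_Basis) (auto simp: cf_cylinders_def pos_words_def)

lemma topspace_cf_topology: "topspace cf_topology = cf_X - \<rat>"
proof -
  have "cf_X - \<rat> \<subseteq> \<Union>cf_cylinders"
  proof
    fix y assume y: "y \<in> cf_X - \<rat>"
    have "cf_cylinder (block (capply_digit_in_unit y) 0 1) \<in> cf_cylinders"
      unfolding cf_cylinders_def using block_digits_pos[OF y, of 0 1] by (force simp: block_def)
    then show "y \<in> \<Union>cf_cylinders" using mem_cf_cylinder_digits[OF y] by blast
  qed
  then show ?thesis by (simp add: cf_topology_def topology_generated_by_topspace Int_absorb1)
qed

text \<open>There are only countably many words, so an open set is a countable union of
  cylinders.\<close>

lemma openin_generated_sets:
  assumes "openin (topology_generated_by cf_cylinders) U"
  shows "U \<in> sets cf_borel"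
proof -
  have "U = (\<Union>w\<in>{w\<in>pos_words. cf_cylinder w \<subseteq> U}. cf_cylinder w)"
    using openin_generated_base[OF assms] by blast
  also have "\<dots> \<in> sets cf_borel"
    by (intro sets.countable_UN' image_subsetI cf_cylinder_sets) (auto simp: pos_words_def)
  finally show ?thesis .
qed

lemma openin_cf_topology_sets: "openin cf_topology U \<Longrightarrow> U \<in> sets cf_borel"
proof -
  assume "openin cf_topology U"
  then obtain V where "openin (topology_generated_by cf_cylinders) V" "U = V \<inter> (cf_X - \<rat>)"
    by (auto simp only: cf_topology_def openin_subtopology)
  then show ?thesis using sets.Int[OF openin_generated_sets irrationals_sets] by simp
qed

text \<open>Two irrational points are separated by the cylinders that end at a digit where they
  differ.\<close>

lemma Hausdorff_cf_topology: "Hausdorff_space cf_topology"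
  unfolding Hausdorff_space_def topspace_cf_topology
proof (intro allI impI)
  fix y z assume yz: "y \<in> cf_X - \<rat> \<and> z \<in> cf_X - \<rat> \<and> y \<noteq> z"
  then have "capply_digit_in_unit y \<noteq> capply_digit_in_unit z" using capply_digit_in_unit_inject[of y z] by blast
  then obtain i where i: "capply_digit_in_unit y i \<noteq> capply_digit_in_unit z i" by (auto simp: fun_eq_iff)
  let ?C = "\<lambda>y. cf_cylinder (block (capply_digit_in_unit y) 0 (Suc i))"
  have op: "openin cf_topology (?C x \<inter> (cf_X - \<rat>))" if "x \<in> cf_X - \<rat>" for x
    unfolding cf_topology_def openin_subtopology using block_digits_pos[OF that, of 0 "Suc i"]
    by (intro exI[of _ "?C x"] conjI openin_cf_cylinder refl) (auto simp: block_def pos_words_def)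
  have "block (capply_digit_in_unit y) 0 (Suc i) \<noteq> block (capply_digit_in_unit z) 0 (Suc i)"
    using i by (simp add: block_def)
  then have "disjnt (?C y \<inter> (cf_X - \<rat>)) (?C z \<inter> (cf_X - \<rat>))"
    unfolding disjnt_iff
    using cf_cylinder_prefix[of _ "block (capply_digit_in_unit y) 0 (Suc i)" "block (capply_digit_in_unit z) 0 (Suc i)"]
    by (metis IntD1 length_block nat_le_linear order_refl take_all)
  moreover have "y \<in> ?C y \<inter> (cf_X - \<rat>)" "z \<in> ?C z \<inter> (cf_X - \<rat>)"
    using yz mem_cf_cylinder_digits by auto
  moreover have "openin cf_topology (?C y \<inter> (cf_X - \<rat>))" "openin cf_topology (?C z \<inter> (cf_X - \<rat>))"
    using yz by (auto intro!: op)
  ultimately show "\<exists>U V. openin cf_topology U \<and> openin cf_topology V \<and> y \<in> U \<and> z \<in> V \<and> disjnt U V"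
    by (intro exI conjI)
qed

text \<open>The value of \<open>measure\<close> on a non-measurable set is 0; measurability of
  compact sets makes the tightness condition a genuine bound on mass.\<close>

lemma compactin_cf_topology_sets:
  assumes "compactin cf_topology K"
  shows "K \<in> sets cf_borel"
proof -
  have K: "closedin cf_topology K"
    by (rule compactin_imp_closedin[OF Hausdorff_cf_topology assms])
  then have "K = (cf_X - \<rat>) - (topspace cf_topology - K)"
    using closedin_subset[OF K] by (auto simp: topspace_cf_topology)
  also have "\<dots> \<in> sets cf_borel"
    using K by (intro sets.Diff[OF irrationals_sets] openin_cf_topology_sets) (simp add: closedin_def)
  finally show ?thesis .
qed

lemma measure_empirical_measure:
  assumes "A \<in> sets cf_borel"
  shows "measure (empirical_measure y n) A = freq (\<lambda>i. (cf_T ^^ i) y \<in> A) n"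
proof -
  have "(\<Sum>i<n. indicator A ((cf_T ^^ i) y)) = ennreal (\<Sum>i<n. of_bool ((cf_T ^^ i) y \<in> A))"
  proof -
    have "(\<Sum>i<n. indicator A ((cf_T ^^ i) y)) = (\<Sum>i<n. ennreal (of_bool ((cf_T ^^ i) y \<in> A)))"
      by (intro sum.cong) (auto simp: indicator_def)
    also have "\<dots> = ennreal (\<Sum>i<n. of_bool ((cf_T ^^ i) y \<in> A))" by (rule sum_ennreal) simp
    finally show ?thesis .
  qed
  then have "emeasure (empirical_measure y n) A = ennreal (freq (\<lambda>i. (cf_T ^^ i) y \<in> A) n)"
    unfolding emeasure_empirical_measure[OF assms] freq_def
    by (simp add: ennreal_mult[symmetric] sum_nonneg)
  then show ?thesis by (simp add: measure_def freq_nonneg)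
qed

text \<open>The cylinders of rank one form an open cover, of which finitely many suffice.\<close>

lemma compactin_first_digit_bounded:
  assumes "compactin cf_topology K"
  shows "\<exists>A. \<forall>y\<in>K. y \<in> cf_X - \<rat> \<and> capply_digit_in_unit y 0 \<le> A"
proof -
  let ?C = "\<lambda>k. cf_cylinder [Suc k] \<inter> (cf_X - \<rat>)"
  have K: "K \<subseteq> cf_X - \<rat>" using compactin_subset_topspace[OF assms] by (simp add: topspace_cf_topology)
  have "openin cf_topology U" if U: "U \<in> range ?C" for U
  proof -
    obtain k where k: "U = ?C k" using U by (rule imageE)
    have "[Suc k] \<in> pos_words" by (simp add: pos_words_def)
    then show ?thesis unfolding k cf_topology_def openin_subtopology using openin_cf_cylinder by blast
  qed
  moreover have "K \<subseteq> \<Union>(range ?C)"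
  proof
    fix y assume "y \<in> K"
    then have y: "y \<in> cf_X - \<rat>" using K by auto
    have "block (capply_digit_in_unit y) 0 1 = [Suc (capply_digit_in_unit y 0 - 1)]"
      using capply_digit_in_unit_pos[OF y, of 0] by (simp add: block_def)
    then show "y \<in> \<Union>(range ?C)" using mem_cf_cylinder_digits[OF y, of 1] y by auto
  qed
  ultimately obtain \<F> where \<F>: "finite \<F>" "\<F> \<subseteq> range ?C" "K \<subseteq> \<Union>\<F>"
    using assms unfolding compactin_def by meson
  then obtain I where I: "finite I" "\<F> = ?C ` I" by (meson finite_subset_image)
  have "capply_digit_in_unit y 0 \<le> Max (insert 0 (Suc ` I))" if y: "y \<in> K" for y
  proof -
    obtain k where k: "k \<in> I" "y \<in> cf_cylinder [Suc k]"
      using y \<F>(3) unfolding I(2) by blast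
    then have "capply_digit_in_unit y 0 = Suc k" by (simp add: cf_cylinder_def capply_digit_in_unit_def)
    then show ?thesis using I k by (intro Max_ge) auto
  qed
  then show ?thesis using K by blast
qed

lemma exists_disjoint_cylinders:
  assumes "openin (topology_generated_by cf_cylinders) V"
  shows "\<exists>C \<subseteq> pos_words. disjoint_family_on cf_cylinder C \<and> V = (\<Union>w\<in>C. cf_cylinder w)"
proof -
  \<comment> \<open>The words of the maximal cylinders inside \<open>V\<close>: no shorter nonempty
    prefix stays in \<open>V\<close>. Maximality makes them disjoint, and a shortest word around a
    point shows that they cover \<open>V\<close>.\<close>
  define C where "C = {w\<in>pos_words. cf_cylinder w \<subseteq> V \<and> (\<forall>m. 1 \<le> m \<and> m < length w \<longrightarrow> \<not> cf_cylinder (take m w) \<subseteq> V)}"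
  have "V \<subseteq> (\<Union>w\<in>C. cf_cylinder w)"
  proof
    fix y assume "y \<in> V"
    define P where "P w \<longleftrightarrow> w \<in> pos_words \<and> y \<in> cf_cylinder w \<and> cf_cylinder w \<subseteq> V" for w
    obtain v where "P v" using openin_generated_base[OF assms \<open>y \<in> V\<close>] by (auto simp: P_def)
    then obtain w where w: "P w" "\<And>u. P u \<Longrightarrow> length w \<le> length u"
      using ex_has_least_nat[of P v length] by blast
    have "w \<in> C" unfolding C_def
    proof (intro CollectI conjI allI impI)
      fix m assume m: "1 \<le> m \<and> m < length w"
      have "take m w \<in> pos_words"
        using w(1) m by (auto simp: P_def pos_words_def dest: in_set_takeD)
      moreover have "y \<in> cf_cylinder (take m w)"
        using w(1) cf_cylinder_take[of w m] by (auto simp: P_def)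
      ultimately show "\<not> cf_cylinder (take m w) \<subseteq> V"
        using w(2)[of "take m w"] m by (auto simp: P_def)
    qed (use w(1) in \<open>auto simp: P_def\<close>)
    then show "y \<in> (\<Union>w\<in>C. cf_cylinder w)" using w(1) by (auto simp: P_def)
  qed
  moreover have "disjoint_family_on cf_cylinder C"
    unfolding disjoint_family_on_def
  proof (intro ballI impI)
    have *: "u = v" if uv: "u \<in> C" "v \<in> C" "y \<in> cf_cylinder u" "y \<in> cf_cylinder v" "length u \<le> length v" for u v y
    proof -
      have u: "u = take (length u) v" by (rule cf_cylinder_prefix[OF uv(3-5)])
      have "1 \<le> length u" using uv(1) by (cases u) (auto simp: C_def pos_words_def)
      moreover have "cf_cylinder (take (length u) v) \<subseteq> V" unfolding u[symmetric] using uv(1) by (simp add: C_def)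
      ultimately have "\<not> length u < length v" using uv(2) by (auto simp: C_def)
      then show "u = v" using u uv(5) by simp
    qed
    fix u v assume "u \<in> C" "v \<in> C" "u \<noteq> v"
    then have "y \<notin> cf_cylinder v" if "y \<in> cf_cylinder u" for y
      using *[of u v y] *[of v u y] that nat_le_linear by blast
    then show "cf_cylinder u \<inter> cf_cylinder v = {}" by blast
  qed
  ultimately show ?thesis by (intro exI[of _ C]) (auto simp: C_def)
qed

text \<open>Continuity of the measure from below along an enumeration of the disjoint
  cylinders.\<close>

lemma finite_cylinder_approximation:
  assumes V: "openin (topology_generated_by cf_cylinders) V" and \<epsilon>: "0 < \<epsilon>"
  shows "\<exists>F \<subseteq> pos_words. finite F \<and> disjoint_family_on cf_cylinder F \<and> (\<Union>w\<in>F. cf_cylinder w) \<subseteq> V \<and>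
    measure gauss_measure V - \<epsilon> < (\<Sum>w\<in>F. gauss_word w)"
proof -
  interpret prob_space gauss_measure by (rule prob_space_gauss_measure)
  obtain C where C: "C \<subseteq> pos_words" "disjoint_family_on cf_cylinder C" "V = (\<Union>w\<in>C. cf_cylinder w)"
    using exists_disjoint_cylinders[OF V] by blast
  show ?thesis
  proof (cases "C = {}")
    case True
    then show ?thesis using C \<epsilon> by (intro exI[of _ "{}"]) (simp add: disjoint_family_on_def)
  next
    case False
    let ?e = "from_nat_into C"
    define E where "E n = (\<Union>w\<in>?e ` {..<n}. cf_cylinder w)" for n
    have F: "?e ` {..<n} \<subseteq> C" for n using from_nat_into[OF False] by auto
    have pos: "\<forall>k\<in>set w. 1 \<le> k" if "w \<in> ?e ` {..<n}" for w n
      using that F[of n] C(1) by (auto simp only: pos_words_def)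
    have sets: "E n \<in> sets gauss_measure" for n
      unfolding E_def by (intro sets.finite_UN subsetD[OF sets_cf_borel_subset] cf_cylinder_sets pos) auto
    have "incseq E" unfolding E_def incseq_def by (intro allI impI UN_mono image_mono) auto
    then have "(\<lambda>n. measure gauss_measure (E n)) \<longlonglongrightarrow> measure gauss_measure (\<Union>n. E n)"
      using sets by (intro finite_Lim_measure_incseq) auto
    also have "(\<Union>n. E n) = (\<Union>w\<in>range ?e. cf_cylinder w)" unfolding E_def by (force intro: lessI)
    also have "range ?e = C" using False by (intro range_from_nat_into) auto
    finally have "(\<lambda>n. measure gauss_measure (E n)) \<longlonglongrightarrow> measure gauss_measure V" using C(3) by simp
    then have "\<forall>\<^sub>F n in sequentially. measure gauss_measure V - \<epsilon> < measure gauss_measure (E n)"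
      by (rule order_tendstoD) (use \<epsilon> in simp)
    then obtain n where n: "measure gauss_measure V - \<epsilon> < measure gauss_measure (E n)"
      by (auto simp: eventually_sequentially)
    have dis: "disjoint_family_on cf_cylinder (?e ` {..<n})"
      by (rule disjoint_family_on_mono[OF F C(2)])
    have "measure gauss_measure (E n) = (\<Sum>w\<in>?e ` {..<n}. gauss_word w)"
      unfolding E_def by (intro measure_Union_cf_cylinders pos dis) auto
    then show ?thesis using n dis F[of n] C by (intro exI[of _ "?e ` {..<n}"]) auto
  qed
qed

section \<open>From cylinders to sets with null frontier\<close>

locale cf_normal_orbit =
  fixes x :: real
  assumes irrational: "x \<in> cf_X - \<rat>"
    and freq_tendsto: "w \<in> pos_words \<Longrightarrow> freq (\<lambda>n. block (capply_digit_in_unit x) n (length w) = w) \<longlonglongrightarrow> gauss_word w"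
begin

lemma freq_open_lower:
  assumes U: "openin cf_topology U" and \<epsilon>: "0 < \<epsilon>"
  shows "\<forall>\<^sub>F N in sequentially. measure gauss_measure U - \<epsilon> \<le> freq (\<lambda>n. (cf_T ^^ n) x \<in> U) N"
proof -
  interpret prob_space gauss_measure by (rule prob_space_gauss_measure)
  obtain V where V: "openin (topology_generated_by cf_cylinders) V" "U = V \<inter> (cf_X - \<rat>)"
    using U by (auto simp: cf_topology_def openin_subtopology)
  have le: "measure gauss_measure U \<le> measure gauss_measure V"
    using V openin_generated_sets[OF V(1)] sets_cf_borel_subset by (intro finite_measure_mono) auto
  have "0 < \<epsilon> / 2" using \<epsilon> by simp
  then obtain F where F: "F \<subseteq> pos_words" "finite F" "disjoint_family_on cf_cylinder F"
     "(\<Union>w\<in>F. cf_cylinder w) \<subseteq> V" "measure gauss_measure V - \<epsilon> / 2 < (\<Sum>w\<in>F. gauss_word w)"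
    using finite_cylinder_approximation[OF V(1)] by meson
  have "(\<lambda>N. \<Sum>w\<in>F. freq (\<lambda>n. block (capply_digit_in_unit x) n (length w) = w) N) \<longlonglongrightarrow> (\<Sum>w\<in>F. gauss_word w)"
    using F(1) by (intro tendsto_sum freq_tendsto) auto
  then have "\<forall>\<^sub>F N in sequentially. (\<Sum>w\<in>F. gauss_word w) - \<epsilon> / 2 < (\<Sum>w\<in>F. freq (\<lambda>n. block (capply_digit_in_unit x) n (length w) = w) N)"
    by (rule order_tendstoD) (use \<epsilon> in simp)
  then show ?thesis
  proof eventually_elim
    case (elim N)
    have "(\<Sum>w\<in>F. freq (\<lambda>n. block (capply_digit_in_unit x) n (length w) = w) N) =
        (\<Sum>w\<in>F. freq (\<lambda>n. (cf_T ^^ n) x \<in> cf_cylinder w) N)"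
      by (simp only: mem_cf_cylinder_iff[OF irrational])
    also have "\<dots> = freq (\<lambda>n. \<exists>w\<in>F. (cf_T ^^ n) x \<in> cf_cylinder w) N"
      using F(2,3) by (intro freq_Ex_disjoint[symmetric]) (auto simp: disjoint_family_on_def)
    also have "\<dots> \<le> freq (\<lambda>n. (cf_T ^^ n) x \<in> U) N"
      using F(4) V(2) funpow_cf_T_irrational[OF irrational] by (intro freq_mono) blast
    finally show ?case using elim F(5) le by linarith
  qed
qed

text \<open>The lower bound for open sets is applied to the interiors of \<open>B\<close> and of its
  complement. Their measures add up to 1 when the frontier is null, so the two lower bounds enclose
  the frequency.\<close>

lemma freq_tendsto_measure:
  assumes B: "B \<in> sets cf_borel" and null: "cf_topology frontier_of B \<in> null_sets gauss_measure"
  shows "freq (\<lambda>n. (cf_T ^^ n) x \<in> B) \<longlonglongrightarrow> measure gauss_measure B"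
proof -
  interpret prob_space gauss_measure by (rule prob_space_gauss_measure)
  let ?Irr = "cf_X - \<rat>"
  define U where "U = cf_topology interior_of B"
  define V where "V = cf_topology interior_of (?Irr - B)"
  have U: "openin cf_topology U" "U \<subseteq> B" by (auto simp: U_def interior_of_subset)
  have V: "openin cf_topology V" "V \<subseteq> ?Irr - B" by (auto simp only: V_def interior_of_subset openin_interior_of)
  have sets: "U \<in> sets gauss_measure" "V \<in> sets gauss_measure" "B \<in> sets gauss_measure" "?Irr \<in> sets gauss_measure"
    using openin_cf_topology_sets[OF U(1)] openin_cf_topology_sets[OF V(1)] B irrationals_sets sets_cf_borel_subset
    by auto
  have "?Irr = (U \<union> V) \<union> cf_topology frontier_of B"
  proof -
    have c: "cf_topology closure_of B = ?Irr - V"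
      unfolding V_def closure_of_interior_of topspace_cf_topology ..
    have "U \<subseteq> ?Irr" "V \<subseteq> ?Irr" using openin_subset[OF U(1)] openin_subset[OF V(1)] by (auto simp: topspace_cf_topology)
    then show ?thesis unfolding frontier_of_def c U_def[symmetric] by blast
  qed
  then have "measure gauss_measure ?Irr = measure gauss_measure (U \<union> V)"
    using null sets by (simp add: measure_Un_null_set)
  also have "\<dots> = measure gauss_measure U + measure gauss_measure V"
    using sets U V by (intro finite_measure_Union) auto
  finally have UV: "measure gauss_measure U + measure gauss_measure V = 1"
  proof -
    have "measure gauss_measure (cf_X - (cf_X \<inter> \<rat>)) = measure gauss_measure cf_X"
      using gauss_measure_Rats sets.top[of gauss_measure] by (intro measure_Diff_null_set) (auto simp: space_gauss_measure)
    moreover have "cf_X - (cf_X \<inter> \<rat>) = ?Irr" by blast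
    moreover have "measure gauss_measure cf_X = 1" using prob_space by (simp add: space_gauss_measure)
    moreover assume "measure gauss_measure ?Irr = measure gauss_measure U + measure gauss_measure V"
    ultimately show ?thesis by simp
  qed
  have "measure gauss_measure U \<le> measure gauss_measure B"
    using U sets by (intro finite_measure_mono) auto
  moreover have "measure gauss_measure B + measure gauss_measure V = measure gauss_measure (B \<union> V)"
    using sets V by (intro finite_measure_Union[symmetric]) auto
  \<comment> \<open>As \<open>V\<close> is disjoint from \<open>B\<close>, the measure of
    \<open>B\<close> is at most 1 minus that of \<open>V\<close>, which is the measure of
    \<open>U\<close>.\<close>
  ultimately have BU: "measure gauss_measure B = measure gauss_measure U"
    using UV prob_le_1[of "B \<union> V"] by linarith
  show ?thesis
  proof (rule tendstoI)
    fix \<epsilon> :: real assume "0 < \<epsilon>"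
    then have "0 < \<epsilon> / 2" by simp
    from freq_open_lower[OF U(1) this] freq_open_lower[OF V(1) this] eventually_ge_at_top[of 1]
    show "\<forall>\<^sub>F N in sequentially. dist (freq (\<lambda>n. (cf_T ^^ n) x \<in> B) N) (measure gauss_measure B) < \<epsilon>"
    proof eventually_elim
      case (elim N)
      have "freq (\<lambda>n. (cf_T ^^ n) x \<in> U) N \<le> freq (\<lambda>n. (cf_T ^^ n) x \<in> B) N"
        using U(2) by (intro freq_mono) blast
      moreover have "freq (\<lambda>n. (cf_T ^^ n) x \<in> V) N \<le> freq (\<lambda>n. \<not> (cf_T ^^ n) x \<in> B) N"
        using V(2) by (intro freq_mono) blast
      moreover have "freq (\<lambda>n. \<not> (cf_T ^^ n) x \<in> B) N = 1 - freq (\<lambda>n. (cf_T ^^ n) x \<in> B) N"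
        by (rule freq_not[OF elim(3)])
      ultimately show ?case using elim(1,2) UV BU \<open>0 < \<epsilon>\<close> by (simp add: dist_real_def abs_less_iff)
    qed
  qed
qed

end

text \<open>A compact set bounds the first digit of its points, so a large digit at time
  \<open>n\<close> means that the iterate lies outside it.\<close>

lemma tight_digits:
  assumes x: "x \<in> cf_X" and tight: "cf_tight {empirical_measure x n | n. 1 \<le> n}"
  shows "x \<notin> \<rat>" and "0 < \<epsilon> \<Longrightarrow> \<exists>A. \<forall>N\<ge>1. freq (\<lambda>n. A < capply_digit_in_unit x n) N \<le> \<epsilon>"
proof -
  have K: "\<exists>K. compactin cf_topology K \<and> K \<in> sets cf_borel \<and> (\<forall>n\<ge>1. freq (\<lambda>i. (cf_T ^^ i) x \<notin> K) n < \<epsilon>)"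
    if "0 < \<epsilon>" for \<epsilon>
  proof -
    obtain K where K: "compactin cf_topology K" "\<And>n. 1 \<le> n \<Longrightarrow> measure (empirical_measure x n) (cf_X - K) < \<epsilon>"
      using tight \<open>0 < \<epsilon>\<close> unfolding cf_tight_def by blast
    have s: "K \<in> sets cf_borel" by (rule compactin_cf_topology_sets[OF K(1)])
    have "cf_X - K \<in> sets cf_borel" using sets.compl_sets[OF s] by (simp add: space_cf_borel)
    then have "measure (empirical_measure x n) (cf_X - K) = freq (\<lambda>i. (cf_T ^^ i) x \<notin> K) n" for n
      using cf_T_in_X[OF x] by (simp add: measure_empirical_measure)
    then show ?thesis using K s by auto
  qed
  show "x \<notin> \<rat>"
  proof
    assume "x \<in> \<rat>"
    \<comment> \<open>For \<open>n = 1\<close> the empirical measure is the point mass at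
      \<open>x\<close>, which no compact set of irrationals can carry if \<open>x\<close> is
      rational.\<close>
    obtain K where K: "compactin cf_topology K" "freq (\<lambda>i. (cf_T ^^ i) x \<notin> K) 1 < 1"
      using K[of 1] by auto
    have "x \<notin> K" using compactin_subset_topspace[OF K(1)] \<open>x \<in> \<rat>\<close> by (auto simp: topspace_cf_topology)
    then show False using K(2) by (simp add: freq_def)
  qed
  assume "0 < \<epsilon>"
  then obtain K where K: "compactin cf_topology K" "\<And>n. 1 \<le> n \<Longrightarrow> freq (\<lambda>i. (cf_T ^^ i) x \<notin> K) n < \<epsilon>"
    using K[of \<epsilon>] by auto
  obtain A where A: "\<And>y. y \<in> K \<Longrightarrow> capply_digit_in_unit y 0 \<le> A" using compactin_first_digit_bounded[OF K(1)] by blast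
  have "freq (\<lambda>n. A < capply_digit_in_unit x n) N \<le> \<epsilon>" if "1 \<le> N" for N
  proof -
    have "freq (\<lambda>n. A < capply_digit_in_unit x n) N \<le> freq (\<lambda>i. (cf_T ^^ i) x \<notin> K) N"
    proof (rule freq_mono)
      fix n assume "A < capply_digit_in_unit x n"
      then show "(cf_T ^^ n) x \<notin> K" using A[of "(cf_T ^^ n) x"] by (auto simp: capply_digit_in_unit_def)
    qed
    then show ?thesis using K(2)[OF that] by linarith
  qed
  then show "\<exists>A. \<forall>N\<ge>1. freq (\<lambda>n. A < capply_digit_in_unit x n) N \<le> \<epsilon>" by blast
qed

text \<open>With l = ln(1/t), completing the square gives sqrt l \<le> \<eta> l + 1/(4\<eta>), so
  the growth is slower than any negative power of t.\<close>

lemma bigo_exp_sqrt_ln_imp_le_powr: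
  fixes \<psi> :: "real \<Rightarrow> real"
  assumes "\<psi> \<in> O[at_right 0](\<lambda>t. exp (sqrt (ln (1 / t))))" and \<eta>: "0 < \<eta>"
  shows "\<exists>C>0. \<exists>t0>0. \<forall>t. 0 < t \<and> t < t0 \<longrightarrow> \<psi> t \<le> C * t powr (- \<eta>)"
proof -
  obtain c where c: "0 < c" "\<forall>\<^sub>F t in at_right 0. norm (\<psi> t) \<le> c * norm (exp (sqrt (ln (1 / t))))"
    using assms(1) by (elim landau_o.bigE)
  from c(2) obtain b where b: "0 < b" "\<And>t. 0 < t \<Longrightarrow> t < b \<Longrightarrow> norm (\<psi> t) \<le> c * norm (exp (sqrt (ln (1 / t))))"
    unfolding eventually_at_right_field by auto
  define C where "C = c * exp (1 / (4 * \<eta>))"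
  have "\<psi> t \<le> C * t powr (- \<eta>)" if t: "0 < t" "t < min b 1" for t
  proof -
    define l where "l = ln (1 / t)"
    have l: "0 \<le> l" using t by (simp add: l_def)
    have "0 \<le> (\<eta> * sqrt l - 1 / 2)\<^sup>2 / \<eta>" using \<eta> by simp
    also have "\<dots> = \<eta> * l - sqrt l + 1 / (4 * \<eta>)"
      using \<eta> l by (simp add: power2_eq_square field_simps)
    finally have "sqrt l \<le> 1 / (4 * \<eta>) + \<eta> * l" by simp
    then have "exp (sqrt l) \<le> exp (1 / (4 * \<eta>)) * exp (\<eta> * l)" by (simp add: exp_add[symmetric])
    moreover have "exp (\<eta> * l) = t powr (- \<eta>)" using t by (simp add: powr_def l_def ln_div)
    moreover have "\<psi> t \<le> c * exp (sqrt l)" using b(2)[of t] t by (simp add: l_def)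
    ultimately have "\<psi> t \<le> c * exp (sqrt l)" "c * exp (sqrt l) \<le> c * (exp (1 / (4 * \<eta>)) * t powr (- \<eta>))"
      using c(1) by (auto intro: mult_left_mono)
    then show ?thesis by (simp add: C_def mult.assoc)
  qed
  moreover have "0 < C" using c by (simp add: C_def)
  moreover have "0 < min b 1" using b by simp
  ultimately show ?thesis by blast
qed

lemma indicator_sum_eq_freq:
  "1 / real N * (\<Sum>n<N. indicator A (f n)) = freq (\<lambda>n. f n \<in> A) N"
  by (simp add: freq_def indicator_def)

text \<open>The condition on the frontier cannot be dropped: the orbit of \<open>x\<close> is a
  countable Borel set of Gauss measure 0 that is visited with frequency 1.\<close>

theorem theorem2:
  fixes x :: real and \<psi> :: "real \<Rightarrow> real"
  assumes "x \<in> cf_X"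
    and "cf_tight {empirical_measure x n | n. 1 \<le> n}"
    and "\<And>t. 0 < t \<Longrightarrow> 0 \<le> \<psi> t"
    and "\<And>\<eta>. 0 < \<eta> \<Longrightarrow> \<psi> \<in> O[at_right 0](\<lambda>t. exp (\<eta> * sqrt (ln (1 / t))))"
    and "\<And>I. I \<in> cf_cylinders \<Longrightarrow>
           limsup (\<lambda>N. ereal (1 / real N * (\<Sum>n<N. indicator I ((cf_T ^^ n) x))))
             \<le> ereal (measure gauss_measure I * \<psi> (measure gauss_measure I))"
  shows "\<forall>B \<in> sets cf_borel. cf_topology frontier_of B \<in> null_sets gauss_measure \<longrightarrow>
           (\<lambda>N. 1 / real N * (\<Sum>n<N. indicator B ((cf_T ^^ n) x)))
             \<longlonglongrightarrow> measure gauss_measure B"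
proof -
  have irr: "x \<in> cf_X - \<rat>" using tight_digits(1)[OF assms(1,2)] assms(1) by simp
  interpret cf_normality "capply_digit_in_unit x"
  proof
    show "1 \<le> capply_digit_in_unit x n" for n by (rule capply_digit_in_unit_pos[OF irr])
    show "\<exists>A. \<forall>N\<ge>1. freq (\<lambda>n. A < capply_digit_in_unit x n) N \<le> \<epsilon>" if "0 < \<epsilon>" for \<epsilon>
      by (rule tight_digits(2)[OF assms(1,2) that])
    fix \<eta> :: real assume \<eta>: "0 < \<eta>" "\<eta> \<le> 1 / 4"
    have "\<psi> \<in> O[at_right 0](\<lambda>t. exp (sqrt (ln (1 / t))))" using assms(4)[of 1] by simp
    then obtain C t0 where C: "0 < C" "0 < t0" "\<And>t. 0 < t \<Longrightarrow> t < t0 \<Longrightarrow> \<psi> t \<le> C * t powr (- \<eta>)"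
      using bigo_exp_sqrt_ln_imp_le_powr[OF _ \<eta>(1)] by meson
    have ln2: "1 / 2 < ln (2::real)" "0 < ln (2::real)" using ln2_ge_two_thirds by linarith+
    have "(\<lambda>k. (1 / 2) ^ k) \<longlonglongrightarrow> (0::real)" by (intro LIMSEQ_realpow_zero) auto
    then have "\<forall>\<^sub>F k in sequentially. (1 / 2) ^ k < t0 / 2" by (rule order_tendstoD) (use C in simp)
    then obtain k0 where k0: "\<And>k. k0 \<le> k \<Longrightarrow> (1 / 2) ^ k < t0 / 2" by (auto simp: eventually_sequentially)
    show "\<exists>C>0. \<exists>k0. \<forall>u. k0 \<le> length u \<longrightarrow> (\<forall>k\<in>set u. 1 \<le> k) \<longrightarrow> (\<forall>\<delta>>0. \<forall>\<^sub>F N in sequentially.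
       freq (\<lambda>n. block (capply_digit_in_unit x) n (length u) = u) N \<le> C * word_prob u 0 powr (1 - \<eta>) + \<delta>)"
    \<comment> \<open>The factor 2 pays for 1/ln 2 < 2 in comparing Gauss measure with length.
      Length at least \<open>k0\<close> brings the measure below \<open>t0\<close>, and length at
      least 1 makes the cylinder one of the generators.\<close>
    proof (rule exI[of _ "2 * C"], intro conjI exI[of _ "max 1 k0"] allI impI)
      fix u :: "nat list" and \<delta> :: real
      assume len: "max 1 k0 \<le> length u" and u: "\<forall>k\<in>set u. 1 \<le> k" and \<delta>: "0 < \<delta>"
      let ?g = "gauss_word u" and ?l = "word_prob u 0"
      have g0: "0 < ?g" by (rule gauss_word_pos[OF u])
      have l0: "0 < ?l" by (rule word_prob_pos[OF u]) simp
      have g2: "?g \<le> 2 * ?l"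
      proof -
        have "?l / ln 2 \<le> ?l / (1 / 2)" using ln2 l0 by (intro divide_left_mono) auto
        then show ?thesis using gauss_word_bounds(1)[OF u] by simp
      qed
      have "?l \<le> (1 / 2) ^ length u" by (rule word_prob_le_power_half[OF u]) simp
      then have gt0: "?g < t0" using g2 k0[of "length u"] len by simp
      have cyl: "cf_cylinder u \<in> cf_cylinders" using u len by (auto simp: cf_cylinders_def)
      have "?g * \<psi> ?g \<le> ?g * (C * ?g powr (- \<eta>))" using g0 gt0 C(3) by (intro mult_left_mono) auto
      also have "\<dots> = C * ?g powr (1 - \<eta>)" using g0 by (simp add: powr_diff powr_minus field_simps)
      also have "\<dots> \<le> C * (2 * ?l) powr (1 - \<eta>)" using g2 g0 C \<eta> by (intro mult_left_mono powr_mono2) auto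
      also have "\<dots> = C * (2 powr (1 - \<eta>) * ?l powr (1 - \<eta>))" using l0 by (simp add: powr_mult)
      also have "\<dots> \<le> C * (2 powr 1 * ?l powr (1 - \<eta>))"
        using C \<eta> by (intro mult_left_mono mult_right_mono powr_mono) auto
      \<comment> \<open>The summand \<delta> makes the inequality strict, so that the bound on the
        upper limit holds for all large \<open>N\<close>.\<close>
      finally have bound: "?g * \<psi> ?g < 2 * C * ?l powr (1 - \<eta>) + \<delta>" using \<delta> by simp
      have "limsup (\<lambda>N. ereal (freq (\<lambda>n. (cf_T ^^ n) x \<in> cf_cylinder u) N)) \<le> ereal (?g * \<psi> ?g)"
        using assms(5)[OF cyl] unfolding indicator_sum_eq_freq measure_cf_cylinder[OF u] .
      also have "\<dots> < ereal (2 * C * ?l powr (1 - \<eta>) + \<delta>)" using bound by simp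
      finally have "\<forall>\<^sub>F N in sequentially. ereal (freq (\<lambda>n. (cf_T ^^ n) x \<in> cf_cylinder u) N)
          < ereal (2 * C * ?l powr (1 - \<eta>) + \<delta>)"
        by (rule Limsup_lessD)
      then show "\<forall>\<^sub>F N in sequentially. freq (\<lambda>n. block (capply_digit_in_unit x) n (length u) = u) N
          \<le> 2 * C * ?l powr (1 - \<eta>) + \<delta>"
        unfolding mem_cf_cylinder_iff[OF irr] by eventually_elim simp
    qed (use C in simp)
  qed
  interpret cf_normal_orbit x
    by unfold_locales (use irr freq_occ_tendsto in \<open>auto simp: pos_words_def\<close>)
  show ?thesis
    unfolding indicator_sum_eq_freq using freq_tendsto_measure by blast
qed

end
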